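(* Let $T \ge 1$ and $N \ge T + \lfloor T^2/4 \rfloor + 2$ be integers, and let $F(T) = T + \lfloor T^2/4 \rfloor + 1$. Consider the variable packet-error coding problem with $N$ packets and at most $T$ adversarially altered packets, with erasure distortion. \begin{enumerate} \item If $0 \le R < \frac{1}{N-T}$, then there is no finite $D$ for which the rate-distortion pair $(R,D)$ is achievable. \item For every $R$ with $\frac{1}{N-T} \le R \le \frac{1}{N-2T}$, the rate-distortion pair $$\left(R,\ \frac{F(T)(N-T)\,(1-(N-2T)R)}{NT}\right)$$ is achievable. \end{enumerate}
   Context: Source alphabet $\mathcal{X} = [K] = \{1,\dots,K\}$ for an integer $K \ge 2$. A code of blocklength $n$ and rate $R$ consists of encoding functions $f_\ell : \mathcal{X}^n \to \mathcal{X}^{nR}$ for $\ell \in [N]$ (the packets $C_\ell = f_\ell(x^n)$) and a decoder $g : \prod_{\ell=1}^N \mathcal{X}^{nR} \to (\mathcal{X}\cup\{e\})^n$, where $e$ is a special erasure symbol. The erasure distortion is $d(x,\hat x)=0$ if $\hat x = x$, $1$ if $\hat x = e$, and $\infty$ otherwise, for $x\in\mathcal{X}$, $\hat x \in \mathcal{X}\cup\{e\}$; for strings, $d(x^n,\hat x^n) = \frac1n\sum_{i=1}^n d(x_i,\hat x_i)$. A code is feasible if $\max_{x^n} d(x^n, g(C_1,\dots,C_N)) = 0$ (exact recovery when no packet is altered). For a code define $$D_T = \max_{x^n \in \mathcal{X}^n}\ \max_{A \subseteq [N],\,|A|\le T}\ \max_{\tilde C_A} d\big(x^n, g(C_{A^c},\tilde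 C_A)\big),$$ where $g(C_{A^c},\tilde C_A)$ is the decoder output when packet $\ell$ equals $f_\ell(x^n)$ for $\ell \notin A$ and is an arbitrary $\tilde C_\ell \in \mathcal{X}^{nR}$ for $\ell \in A$. A pair $(R,D)$ is achievable if for every $\epsilon>0$ there exists a feasible code of some blocklength with rate at most $R+\epsilon$ and $D_T \le D+\epsilon$. *)

theory Defs
  imports "HOL-Analysis.Analysis"
begin

definition strs :: "nat \<Rightarrow> nat \<Rightarrow> nat list set" where
  "strs K n = {xs. length xs = n \<and> set xs \<subseteq> {1..K}}"

(* erasure distortion; None is the erasure symbol e *)
definition sym_dist :: "nat \<Rightarrow> nat option \<Rightarrow> ereal" where
  "sym_dist x y = (case y of None \<Rightarrow> 1 | Some z \<Rightarrow> (if z = x then 0 else \<infinity>))"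

definition str_dist :: "nat list \<Rightarrow> nat option list \<Rightarrow> ereal" where
  "str_dist xs ys = ereal (1 / real (length xs)) * (\<Sum>i<length xs. sym_dist (xs ! i) (ys ! i))"

(* A code with N packets, blocklength n, packet length m = nR (so rate m/n):
   encoders f l (l < N) map [K]^n to [K]^m; decoder g maps a list of N packets to
   an output string of length n over [K] \<union> {e}. *)
definition is_code :: "nat \<Rightarrow> nat \<Rightarrow> nat \<Rightarrow> nat \<Rightarrow>
    (nat \<Rightarrow> nat list \<Rightarrow> nat list) \<Rightarrow> (nat list list \<Rightarrow> nat option list) \<Rightarrow> bool" where
  "is_code K N n m f g \<longleftrightarrow> n > 0 \<and>
     (\<forall>l<N. \<forall>x\<in>strs K n. f l x \<in> strs K m) \<and>
     (\<forall>cs. length cs = N \<and> (\<forall>c\<in>set cs. c \<in> strs K m) \<longrightarrow>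
        length (g cs) = n \<and> (\<forall>y\<in>set (g cs). y = None \<or> the y \<in> {1..K}))"

definition feasible :: "nat \<Rightarrow> nat \<Rightarrow> nat \<Rightarrow>
    (nat \<Rightarrow> nat list \<Rightarrow> nat list) \<Rightarrow> (nat list list \<Rightarrow> nat option list) \<Rightarrow> bool" where
  "feasible K N n f g \<longleftrightarrow> (\<forall>x\<in>strs K n. str_dist x (g (map (\<lambda>l. f l x) [0..<N])) = 0)"

definition altered :: "nat \<Rightarrow> nat \<Rightarrow> nat \<Rightarrow> (nat \<Rightarrow> nat list \<Rightarrow> nat list) \<Rightarrow>
    nat list \<Rightarrow> nat set \<Rightarrow> nat list list set" where
  "altered K N m f x A = {cs. length cs = N \<and> (\<forall>l<N. cs ! l \<in> strs K m) \<and>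
      (\<forall>l<N. l \<notin> A \<longrightarrow> cs ! l = f l x)}"

definition D_T :: "nat \<Rightarrow> nat \<Rightarrow> nat \<Rightarrow> nat \<Rightarrow> nat \<Rightarrow>
    (nat \<Rightarrow> nat list \<Rightarrow> nat list) \<Rightarrow> (nat list list \<Rightarrow> nat option list) \<Rightarrow> ereal" where
  "D_T K N T n m f g = (SUP (x, A, cs) \<in> {(x, A, cs). x \<in> strs K n \<and> A \<subseteq> {0..<N} \<and> card A \<le> T
       \<and> cs \<in> altered K N m f x A}. str_dist x (g cs))"

definition achievable :: "nat \<Rightarrow> nat \<Rightarrow> nat \<Rightarrow> real \<Rightarrow> real \<Rightarrow> bool" where
  "achievable K N T R D \<longleftrightarrow> (\<forall>\<epsilon>>0. \<exists>n m f g. is_code K N n m f g \<and> feasible K N n f g \<and>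
      real m / real n \<le> R + \<epsilon> \<and> D_T K N T n m f g \<le> ereal (D + \<epsilon>))"

end

theory Submission
  imports Defs "HOL-Computational_Algebra.Polynomial"
begin

text \<open>Converse: below rate \<open>1 / (N - T)\<close> two source strings share their first \<open>N - T\<close> packets, and
  altering the remaining \<open>T\<close> packets turns the codeword of one into that of the other, which the
  decoder must decode exactly.

  Achievability: the stated points lie on a segment whose endpoints are reached by Reed--Solomon
  codes over the integers, with dimension \<open>N - 2T\<close> (exact recovery) and \<open>N - T\<close> (erasures), so time
  sharing suffices. For dimension \<open>N - T\<close> every packet also carries the Gram matrix of all packets,
  at asymptotically vanishing rate. Call two received packets consistent if their inner product is the
  transmitted one. By positive definiteness, a packet consistent with \<open>N - T\<close> packets of a
  codeword belongs to that codeword, so the candidate sets of unaltered packets are maximal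
  cliques of the consistency graph with at least \<open>N - T\<close> vertices, and such cliques jointly miss at most
  \<open>F(T) = T + \<lfloor>T\<^sup>2/4\<rfloor> + 1\<close> vertices. Every layer of the code is systematic in a cyclic window of
  packets, so each packet that is never missed reveals a fraction \<open>1/N\<close> of the source in the clear.\<close>

section \<open>Families of large maximal cliques\<close>

lemma mult_diff_le_quarter_square: "c * (T - c) \<le> T\<^sup>2 div 4" for c T :: nat
proof (cases "c \<le> T")
  case True
  then obtain d where T: "T = c + d" using le_Suc_ex by blast
  have "4 * (int c * int d) \<le> (int c + int d)\<^sup>2"
    using zero_le_power2[of "int c - int d"] by (simp add: power2_eq_square algebra_simps)
  hence "4 * (c * d) \<le> T\<^sup>2"
    unfolding T by (metis (mono_tags) of_nat_add of_nat_le_iff of_nat_mult of_nat_numeral of_nat_power)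
  thus ?thesis using T by simp
qed simp

text \<open>Relative to one fixed clique \<open>H\<close>, a vertex leaves the intersection either
  by lying outside \<open>H\<close> or because another clique trades it for outsiders. A vertex of
  \<open>H\<close> is lost only to a non-adjacent outsider, and the size condition allows few losses
  per outsider; the bound then comes from maximising a product whose factors have a fixed
  sum.\<close>

lemma card_complement_Inter_max_cliques:
  fixes V :: "'a set" and F :: "'a set set" and T :: nat
  assumes V: "finite V" and sym: "\<And>a b. R a b \<Longrightarrow> R b a"
    and sub: "\<And>H. H \<in> F \<Longrightarrow> H \<subseteq> V"
    and large: "\<And>H. H \<in> F \<Longrightarrow> card V \<le> card H + T"
    and clique: "\<And>H a b. H \<in> F \<Longrightarrow> a \<in> H \<Longrightarrow> b \<in> H \<Longrightarrow> R a b"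
    and maximal: "\<And>H v. H \<in> F \<Longrightarrow> v \<in> V \<Longrightarrow> R v v \<Longrightarrow> (\<And>h. h \<in> H \<Longrightarrow> R v h) \<Longrightarrow> v \<in> H"
    and H: "H \<in> F"
  shows "card (V - \<Inter>F) \<le> T + T\<^sup>2 div 4 + 1"
proof -
  define M where "M a = {l \<in> H. \<not> R a l}" for a
  \<comment> \<open>\<open>H\<close> misses \<open>T - \<delta>\<close> vertices, so any other
    member of \<open>F\<close> may have up to \<open>\<delta>\<close> fewer vertices than
    \<open>H\<close>.\<close>
  define \<delta> where "\<delta> = T - card (V - H)"
  have finH: "finite H'" if "H' \<in> F" for H' using that sub V finite_subset by blast
  have finF: "finite F" using sub V by (meson Pow_iff finite_Pow_iff finite_subset subsetI)
  have tT: "card (V - H) \<le> T" using large[OF H] card_Diff_subset[OF finH[OF H] sub[OF H]] by simp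
  have M_ne: "M a \<noteq> {}" if "H' \<in> F" "a \<in> H' - H" for H' a
    using maximal[OF H, of a] clique[OF that(1), of a a] that sub by (auto simp: M_def)
  \<comment> \<open>If \<open>H'\<close> drops \<open>l\<close>, maximality of \<open>H'\<close>
    yields a non-neighbour of \<open>l\<close> in \<open>H'\<close>, and it lies outside
    \<open>H\<close> because \<open>H\<close> is a clique. Conversely, a clique containing
    \<open>a\<close> avoids \<open>M a\<close>.\<close>
  have H_diff: "H - H' = (\<Union>a\<in>H' - H. M a)" if H': "H' \<in> F" for H'
  proof
    show "H - H' \<subseteq> (\<Union>a\<in>H' - H. M a)"
    proof
      fix l assume l: "l \<in> H - H'"
      then obtain h where h: "h \<in> H'" "\<not> R l h"
        using maximal[OF H', of l] sub[OF H] clique[OF H, of l l] by blast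
      hence "h \<notin> H" using clique[OF H] l by blast
      thus "l \<in> (\<Union>a\<in>H' - H. M a)" using h l sym by (auto simp: M_def)
    qed
    show "(\<Union>a\<in>H' - H. M a) \<subseteq> H - H'"
      using clique[OF H'] by (auto simp: M_def)
  qed
  have lost: "card (H - H') \<le> card (H' - H) + \<delta>" if H': "H' \<in> F" for H'
  proof -
    have "card V = card H + card (V - H)"
      using V sub[OF H] by (metis card_Diff_subset card_mono finite_subset le_add_diff_inverse)
    moreover have "card H = card (H \<inter> H') + card (H - H')" "card H' = card (H \<inter> H') + card (H' - H)"
      using card_Int_Diff[OF finH[OF H], of H'] card_Int_Diff[OF finH[OF H'], of H]
      by (simp_all add: Int_commute)
    ultimately show ?thesis using large[OF H'] tT unfolding \<delta>_def by linarith
  qed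
  \<comment> \<open>\<open>Z G\<close> is what the subfamily \<open>G\<close> loses from
    \<open>H\<close>, \<open>W G\<close> the outsiders it brings in; by \<open>ZW\<close> the loss
    depends on the outsiders only.\<close>
  define Z where "Z G = (\<Union>H'\<in>G. H - H')" for G
  define W where "W G = (\<Union>H'\<in>G. H' - H)" for G
  have ZW: "Z G = (\<Union>a\<in>W G. M a)" if "G \<subseteq> F" for G
  proof -
    have "Z G = (\<Union>H'\<in>G. \<Union>a\<in>H' - H. M a)"
      unfolding Z_def using H_diff that by (intro SUP_cong) auto
    thus ?thesis unfolding W_def by blast
  qed
  have split: "V - \<Inter>F = (V - H) \<union> Z F"
    unfolding Z_def using H sub by blast
  have total: "card (V - \<Inter>F) \<le> card (V - H) + card (Z F)"
    unfolding split by (rule card_Un_le)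
  have finW: "finite (W G)" if "G \<subseteq> F" for G
    unfolding W_def using that finF finH by (meson finite_Diff finite_UN_I finite_subset subsetD)
  have finZ: "finite (Z G)" for G
    unfolding Z_def using finH[OF H] by (meson Diff_subset UN_least finite_subset)
  have W_sub: "W F \<subseteq> V - H" unfolding W_def using sub by blast
  obtain H1 where H1: "H1 \<in> F" and H1_max: "\<And>H'. H' \<in> F \<Longrightarrow> card (H' - H) \<le> card (H1 - H)"
  proof -
    have "Max ((\<lambda>H'. card (H' - H)) ` F) \<in> (\<lambda>H'. card (H' - H)) ` F"
      using finF H by (intro Max_in) auto
    then obtain H1 where "H1 \<in> F" "card (H1 - H) = Max ((\<lambda>H'. card (H' - H)) ` F)" by auto
    thus thesis using that finF by simp
  qed
  define s where "s = card (H1 - H)"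
  consider "s = 0" | "s = 1" | "s \<ge> 2" by linarith
  thus ?thesis
  proof cases
    case 1
    have "W F = {}"
      using H1_max finH unfolding s_def W_def 1[unfolded s_def] by auto
    hence "Z F = {}" using ZW by simp
    thus ?thesis using total tT by simp
  next
    case 2
    \<comment> \<open>Here \<open>a\<close> is the only outsider of \<open>H'\<close>, so
      \<open>H'\<close> loses at most the one vertex it replaces plus the slack
      \<open>\<delta>\<close>.\<close>
    have "card (M a) \<le> 1 + \<delta>" if a: "a \<in> W F" for a
    proof -
      obtain H' where H': "H' \<in> F" "a \<in> H' - H" using a unfolding W_def by blast
      have "M a \<subseteq> H - H'" using H_diff[OF H'(1)] H'(2) by blast
      hence "card (M a) \<le> card (H - H')" using finH[OF H] by (simp add: card_mono)
      also have "\<dots> \<le> 1 + \<delta>" using lost[OF H'(1)] H1_max[OF H'(1)] 2 unfolding s_def by linarith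
      finally show ?thesis .
    qed
    hence "card (Z F) \<le> card (W F) * (1 + \<delta>)"
      unfolding ZW[OF subset_refl] using card_UN_le[OF finW[OF subset_refl], of M]
        sum_bounded_above[of "W F" "\<lambda>a. card (M a)" "1 + \<delta>"] by simp
    also have "\<dots> \<le> card (V - H) * (1 + \<delta>)"
      using card_mono[OF _ W_sub] V by (intro mult_le_mono1) simp
    \<comment> \<open>With \<open>t = card (V - H)\<close> the sum is
      \<open>t + t * (1 + T - t)\<close>. Expanding the square of \<open>T + 2\<close> below
      produces exactly the summand \<open>T + 1\<close>.\<close>
    finally have "card (V - \<Inter>F) \<le> card (V - H) * (T + 2 - card (V - H))"
      using total tT unfolding \<delta>_def by (simp add: Suc_diff_le)
    also have "\<dots> \<le> (T + 2)\<^sup>2 div 4" by (rule mult_diff_le_quarter_square)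
    also have "(T + 2)\<^sup>2 = T\<^sup>2 + 4 * (T + 1)" by (simp add: power2_eq_square)
    finally show ?thesis by simp
  next
    case 3
    \<comment> \<open>\<open>c + 1 = s + \<delta>\<close> bounds what any single clique loses; only
      the first clique pays the extra \<open>1\<close>.\<close>
    define c where "c = s - 1 + \<delta>"
    txt \<open>Add the cliques one by one. Each adds at most \<open>c\<close> lost vertices per new vertex outside
      \<open>H\<close>: if it meets an earlier outsider, one of its lost vertices has been counted already.\<close>
    have bound: "G \<subseteq> F \<Longrightarrow> card (Z (insert H1 G)) + s * c \<le> c + 1 + card (W (insert H1 G)) * c"
      if "finite G" for G
      using that
    proof (induction G rule: finite_induct)
      case empty
      have "card (Z {H1}) \<le> c + 1" using lost[OF H1] 3 unfolding Z_def c_def s_def by simp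
      thus ?case unfolding W_def s_def by simp
    next
      case (insert H' G)
      let ?G = "insert H1 G"
      have H': "H' \<in> F" and G: "?G \<subseteq> F" using insert.prems H1 by auto
      have Z': "Z (insert H1 (insert H' G)) = Z ?G \<union> (H - H' - Z ?G)"
        and W': "W (insert H1 (insert H' G)) = W ?G \<union> (H' - H - W ?G)"
        unfolding Z_def W_def by auto
      have cW: "card (W (insert H1 (insert H' G))) = card (W ?G) + card (H' - H - W ?G)"
        unfolding W' using finW[OF G] finH[OF H'] by (intro card_Un_disjoint) auto
      have cZ: "card (Z (insert H1 (insert H' G))) \<le> card (Z ?G) + card (H - H' - Z ?G)"
        unfolding Z' by (rule card_Un_le)
      have IH: "card (Z ?G) + s * c \<le> c + 1 + card (W ?G) * c" using insert by simp
      have r_le: "card (H' - H) \<le> s" using H1_max[OF H'] s_def by simp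
      have "card (H - H' - Z ?G) \<le> card (H' - H - W ?G) * c"
      proof (cases "H' - H \<subseteq> W ?G")
        case True
        hence "H - H' \<subseteq> Z ?G" using H_diff[OF H'] ZW[OF G] by blast
        thus ?thesis by (simp add: Diff_eq_empty_iff[THEN iffD2])
      next
        case False
        hence new: "1 \<le> card (H' - H - W ?G)"
          using finH[OF H'] by (simp add: Suc_le_eq card_gt_0_iff)
        show ?thesis
        proof (cases "(H' - H) \<inter> W ?G = {}")
          case True
          hence eq: "H' - H - W ?G = H' - H" by blast
          have "card (H - H' - Z ?G) \<le> card (H - H')"
            using finH[OF H] by (intro card_mono) auto
          also have "\<dots> \<le> card (H' - H) + \<delta>" by (rule lost[OF H'])
          \<comment> \<open>All outsiders of \<open>H'\<close> are new and there is at least one, so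
            \<open>\<delta>\<close> can be charged to each of them; \<open>s \<ge> 2\<close> then
            gives \<open>1 + \<delta> \<le> c\<close>.\<close>
          also have "\<dots> \<le> card (H' - H) * (1 + \<delta>)" using new eq by simp
          also have "\<dots> \<le> card (H' - H) * c" using 3 unfolding c_def by (intro mult_le_mono2) simp
          finally show ?thesis using eq by simp
        next
          case False
          then obtain a where a: "a \<in> H' - H" "a \<in> W ?G" by blast
          obtain l where "l \<in> M a" using M_ne[OF H' a(1)] by blast
          hence l: "l \<in> H - H'" "l \<in> Z ?G" using H_diff[OF H'] ZW[OF G] a by blast+
          have "card (H - H' - Z ?G) \<le> card (H - H' - {l})"
            using finH[OF H] l by (intro card_mono) auto
          also have "\<dots> = card (H - H') - 1" using l by simp
          also have "\<dots> \<le> c" using lost[OF H'] r_le 3 unfolding c_def by linarith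
          also have "\<dots> \<le> card (H' - H - W ?G) * c" using new by simp
          finally show ?thesis .
        qed
      qed
      thus ?case using cZ cW IH by (simp add: algebra_simps)
    qed
    have "card (Z F) + s * c \<le> c + 1 + card (W F) * c"
      using bound[OF finF subset_refl] H1 by (simp add: insert_absorb)
    also have "\<dots> \<le> c + 1 + card (V - H) * c"
      using card_mono[OF _ W_sub] V by (intro add_left_mono mult_le_mono1) simp
    finally have Z: "card (Z F) + s * c \<le> c + 1 + card (V - H) * c" .
    have "s \<le> card (V - H)" unfolding s_def using sub[OF H1] V by (intro card_mono) auto
    \<comment> \<open>The factors \<open>c\<close> and \<open>card (V - H) - s + 1\<close> sum to
      \<open>T\<close>, so the quarter-square bound applies to their product.\<close>
    hence "T - c = card (V - H) - s + 1" using tT 3 unfolding c_def \<delta>_def by linarith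
    moreover have "card (Z F) \<le> 1 + c * (card (V - H) - s + 1)"
    proof -
      obtain d where d: "card (V - H) = s + d" using \<open>s \<le> card (V - H)\<close> le_Suc_ex by blast
      show ?thesis using Z unfolding d by (simp add: algebra_simps)
    qed
    ultimately have "card (Z F) \<le> 1 + T\<^sup>2 div 4"
      using mult_diff_le_quarter_square[of c T] by simp
    thus ?thesis using total tT by simp
  qed
qed

section \<open>Codes without a decoder\<close>

text \<open>The ball of radius \<open>T\<close> around the received word \<open>c\<close>, pulled
  back to the source; the additive form avoids truncated subtraction.\<close>

definition plausible :: "nat \<Rightarrow> nat \<Rightarrow> 'x set \<Rightarrow> (nat \<Rightarrow> 'x \<Rightarrow> 'p) \<Rightarrow> (nat \<Rightarrow> 'p) \<Rightarrow> 'x set" where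
  "plausible N T X f c = {x \<in> X. N \<le> card {l. l < N \<and> f l x = c l} + T}"

lemma plausibleD: "x \<in> plausible N T X f c \<Longrightarrow> x \<in> X"
  by (simp add: plausible_def)

text \<open>\<open>v x i\<close> is coordinate \<open>i\<close> of the source element \<open>x\<close>. The first conjunct is minimum distance
  greater than \<open>T\<close>.\<close>
definition robust :: "nat \<Rightarrow> nat \<Rightarrow> 'x set \<Rightarrow> (nat \<Rightarrow> 'x \<Rightarrow> 'p) \<Rightarrow> 'i set \<Rightarrow> ('x \<Rightarrow> 'i \<Rightarrow> 'v) \<Rightarrow> nat \<Rightarrow> bool" where
  "robust N T X f I v e \<longleftrightarrow>
     (\<forall>x\<in>X. \<forall>x'\<in>plausible N T X f (\<lambda>l. f l x). x' = x) \<and>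
     (\<forall>c. \<forall>x\<in>plausible N T X f c. card {i\<in>I. \<exists>x'\<in>plausible N T X f c. v x' i \<noteq> v x i} \<le> e)"

lemma robustI:
  assumes "\<And>x x'. x \<in> X \<Longrightarrow> x' \<in> X \<Longrightarrow> x' \<in> plausible N T X f (\<lambda>l. f l x) \<Longrightarrow> x' = x"
    and "\<And>c x. x \<in> plausible N T X f c \<Longrightarrow> card {i\<in>I. \<exists>x'\<in>plausible N T X f c. v x' i \<noteq> v x i} \<le> e"
  shows "robust N T X f I v e"
  unfolding robust_def
proof (intro conjI ballI allI)
  fix x x' assume x: "x \<in> X" "x' \<in> plausible N T X f (\<lambda>l. f l x)"
  show "x' = x" by (rule assms(1)[OF x(1) plausibleD[OF x(2)] x(2)])
qed (rule assms(2))

lemma robust_unique: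
  assumes "robust N T X f I v e" "x \<in> X" "x' \<in> plausible N T X f (\<lambda>l. f l x)"
  shows "x' = x"
  using assms unfolding robust_def by simp

lemma robust_ambiguous:
  assumes "robust N T X f I v e" "x \<in> plausible N T X f c"
  shows "card {i\<in>I. \<exists>x'\<in>plausible N T X f c. v x' i \<noteq> v x i} \<le> e"
  using assms unfolding robust_def by simp

text \<open>Agreeing packets still agree after the map, so their number cannot drop. This transfers
  candidates when the alphabet is re-encoded and when a concatenated code is projected to its
  parts.\<close>

lemma plausible_mono:
  assumes "h \<in> X \<rightarrow> X'" "\<And>l x. l < N \<Longrightarrow> x \<in> X \<Longrightarrow> f l x = c l \<Longrightarrow> f' l (h x) = c' l"
    and "x \<in> plausible N T X f c"
  shows "h x \<in> plausible N T X' f' c'"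
proof -
  have "card {l. l < N \<and> f l x = c l} \<le> card {l. l < N \<and> f' l (h x) = c' l}"
    using assms by (intro card_mono) (auto simp: plausible_def)
  thus ?thesis using assms unfolding plausible_def by auto
qed

section \<open>Reed--Solomon codes over the integers\<close>

lemma lagrange_interpolation:
  fixes p :: "'a::field poly"
  assumes H: "finite H" and deg: "degree p < card H"
  shows "poly p t = (\<Sum>h\<in>H. (\<Prod>m\<in>H - {h}. (t - m) / (h - m)) * poly p h)"
proof -
  define B where "B h = smult (poly p h / (\<Prod>m\<in>H - {h}. h - m)) (\<Prod>m\<in>H - {h}. [:- m, 1:])" for h
  define q where "q = (\<Sum>h\<in>H. B h)"
  have poly_B: "poly (B h) t = (\<Prod>m\<in>H - {h}. (t - m) / (h - m)) * poly p h" for h t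
    unfolding B_def by (simp add: poly_prod prod_dividef)
  have poly_q: "poly q t = (\<Sum>h\<in>H. (\<Prod>m\<in>H - {h}. (t - m) / (h - m)) * poly p h)" for t
    unfolding q_def poly_sum poly_B ..
  have "degree (B h) \<le> card H - 1" if "h \<in> H" for h
  proof -
    have "degree (B h) \<le> degree (\<Prod>m\<in>H - {h}. [:- m, 1:])" unfolding B_def by (rule degree_smult_le)
    also have "\<dots> \<le> (\<Sum>m\<in>H - {h}. degree [:- m, 1:])"
      using degree_prod_sum_le[of "H - {h}" "\<lambda>m. [:- m, 1:]"] H by (simp add: o_def)
    also have "\<dots> = card H - 1" using H that by simp
    finally show ?thesis .
  qed
  hence "degree q \<le> card H - 1" unfolding q_def using H by (intro degree_sum_le)
  hence deg': "degree (p - q) < card H" using deg by (intro degree_diff_less) auto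
  have "poly q t = poly p t" if t: "t \<in> H" for t
  proof -
    have "(\<Prod>m\<in>H - {h}. (t - m) / (h - m)) = (if h = t then 1 else 0)" if "h \<in> H" for h
      using that t H by (auto intro!: prod.neutral prod_zero)
    hence "poly q t = (\<Sum>h\<in>H. if h = t then poly p h else 0)"
      unfolding poly_q by (intro sum.cong) auto
    thus ?thesis using t H by simp
  qed
  hence sub: "H \<subseteq> {t. poly (p - q) t = 0}" by auto
  have "p - q = 0"
  proof (rule ccontr)
    assume nz: "p - q \<noteq> 0"
    have "card H \<le> card {t. poly (p - q) t = 0}" using poly_roots_finite[OF nz] sub by (rule card_mono)
    also have "\<dots> \<le> degree (p - q)" using nz by (rule card_poly_roots_bound)
    finally show False using deg' by simp
  qed
  hence "poly p t = poly q t" by simp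
  also note poly_q
  finally show ?thesis .
qed

lemma mod_add_neq:
  fixes i j j' N :: nat
  assumes "j < N" "j' < N" "j \<noteq> j'"
  shows "(i + j) mod N \<noteq> (i + j') mod N"
proof -
  have *: "(i + a) mod N \<noteq> (i + b) mod N" if "a < b" "b < N" for a b
  proof
    assume "(i + a) mod N = (i + b) mod N"
    hence "N dvd (i + b) - (i + a)" using that by (metis add_le_cancel_left less_imp_le mod_eq_dvd_iff_nat)
    thus False using that by (auto dest: dvd_imp_le)
  qed
  show ?thesis using *[of j j'] *[of j' j] assms by (cases "j < j'") auto
qed

text \<open>Layer \<open>i\<close> of the code is systematic in the packets \<open>(i + j) mod N\<close> with \<open>j < k\<close>: source
  coordinate \<open>j\<close> multiplies the polynomial, evaluated at \<open>l\<close> for packet \<open>l\<close>, that vanishes at all the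
  other systematic packets. Leaving out the Lagrange denominators keeps everything integral.\<close>
definition rs_coeff :: "nat \<Rightarrow> nat \<Rightarrow> nat \<Rightarrow> nat \<Rightarrow> nat \<Rightarrow> int" where
  "rs_coeff N k i j l = (\<Prod>j'\<in>{..<k} - {j}. int l - int ((i + j') mod N))"

lemma rs_coeff_other:
  assumes "j' < k" "j' \<noteq> j"
  shows "rs_coeff N k i j ((i + j') mod N) = 0"
  using assms unfolding rs_coeff_def by (intro prod_zero) auto

lemma rs_coeff_self:
  assumes "k \<le> N" "j < k"
  shows "rs_coeff N k i j ((i + j) mod N) \<noteq> 0"
proof -
  have "(i + j) mod N \<noteq> (i + j') mod N" if "j' \<in> {..<k} - {j}" for j'
    using that assms by (intro mod_add_neq) auto
  thus ?thesis unfolding rs_coeff_def by simp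
qed

lemma abs_rs_coeff_le:
  assumes "k \<le> N" "l < N"
  shows "\<bar>rs_coeff N k i j l\<bar> \<le> int N ^ N"
proof -
  have "\<bar>rs_coeff N k i j l\<bar> \<le> (\<Prod>j'\<in>{..<k} - {j}. int N)"
    unfolding rs_coeff_def abs_prod
  proof (rule prod_mono)
    fix j'
    have "(i + j') mod N < N" using assms by simp
    thus "0 \<le> \<bar>int l - int ((i + j') mod N)\<bar> \<and> \<bar>int l - int ((i + j') mod N)\<bar> \<le> int N"
      using assms by linarith
  qed
  also have "\<dots> = int N ^ card ({..<k} - {j})" by simp
  also have "\<dots> \<le> int N ^ N"
    using assms card_mono[of "{..<k}" "{..<k} - {j}"] by (intro power_increasing) auto
  finally show ?thesis .
qed

text \<open>The witness consists of the Lagrange weights at \<open>l\<close> for the nodes in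
  \<open>H\<close>, which depend on neither \<open>i\<close> nor \<open>j\<close>. Hence one linear
  relation holds for entire packets, in all layers and columns.\<close>

lemma rs_coeff_interpolate:
  assumes H: "finite H" "k \<le> card H" and k: "k > 0"
  shows "\<exists>c. \<forall>i. \<forall>j<k. real_of_int (rs_coeff N k i j l) = (\<Sum>h\<in>H. c h * real_of_int (rs_coeff N k i j h))"
proof (intro exI allI impI)
  fix i j assume j: "j < k"
  define p where "p = (\<Prod>j'\<in>{..<k} - {j}. [:- real ((i + j') mod N), 1:])"
  have p: "poly p (real l) = real_of_int (rs_coeff N k i j l)" for l
    unfolding p_def rs_coeff_def by (simp add: poly_prod)
  have "degree p \<le> (\<Sum>j'\<in>{..<k} - {j}. degree [:- real ((i + j') mod N), 1:])"
    unfolding p_def using degree_prod_sum_le[of "{..<k} - {j}" "\<lambda>j'. [:- real ((i + j') mod N), 1:]"]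
    by (simp add: o_def)
  hence "degree p < card (real ` H)" using j H by (simp add: card_image)
  hence "poly p (real l) = (\<Sum>h\<in>real ` H. (\<Prod>m\<in>real ` H - {h}. (real l - m) / (h - m)) * poly p h)"
    using H(1) by (intro lagrange_interpolation) auto
  also have "\<dots> = (\<Sum>h\<in>H. (\<Prod>m\<in>real ` H - {real h}. (real l - m) / (real h - m)) * poly p (real h))"
    by (subst sum.reindex) (auto simp: inj_on_def)
  finally show "real_of_int (rs_coeff N k i j l) = (\<Sum>h\<in>H.
      (\<Prod>m\<in>real ` H - {real h}. (real l - m) / (real h - m)) * real_of_int (rs_coeff N k i j h))"
    unfolding p .
qed

text \<open>The pair \<open>x\<close> is a layer \<open>fst x\<close>, which fixes the systematic
  window, and a column \<open>snd x\<close>, one of several independent uses of that layer.\<close>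

definition rs_word :: "nat \<Rightarrow> nat \<Rightarrow> nat \<Rightarrow> (nat \<times> nat \<times> nat \<Rightarrow> nat) \<Rightarrow> nat \<times> nat \<Rightarrow> int" where
  "rs_word N k l \<sigma> x = (\<Sum>j<k. rs_coeff N k (fst x) j l * int (\<sigma> (fst x, j, snd x)))"

lemma rs_word_systematic:
  assumes "k \<le> N" "j < k"
  shows "rs_word N k ((i + j) mod N) \<sigma> (i, q) = rs_coeff N k i j ((i + j) mod N) * int (\<sigma> (i, j, q))"
proof -
  have "rs_word N k ((i + j) mod N) \<sigma> (i, q)
      = (\<Sum>j'<k. if j' = j then rs_coeff N k i j ((i + j) mod N) * int (\<sigma> (i, j, q)) else 0)"
    unfolding rs_word_def using assms rs_coeff_other by (intro sum.cong) auto
  thus ?thesis using assms by simp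
qed

lemma rs_word_systematic_eq:
  assumes "k \<le> N" "j < k" "rs_word N k ((i + j) mod N) \<sigma> (i, q) = rs_word N k ((i + j) mod N) \<sigma>' (i, q)"
  shows "\<sigma> (i, j, q) = \<sigma>' (i, j, q)"
  using assms(3) rs_coeff_self[OF assms(1,2), of i] unfolding rs_word_systematic[OF assms(1,2)] by simp

lemma rs_word_interpolate:
  assumes H: "finite H" "k \<le> card H" and k: "k > 0"
  shows "\<exists>c. \<forall>\<sigma> x. real_of_int (rs_word N k l \<sigma> x) = (\<Sum>h\<in>H. c h * real_of_int (rs_word N k h \<sigma> x))"
proof -
  obtain c where c: "\<And>i j. j < k \<Longrightarrow> real_of_int (rs_coeff N k i j l)
      = (\<Sum>h\<in>H. c h * real_of_int (rs_coeff N k i j h))"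
    using rs_coeff_interpolate[OF assms] by blast
  have "real_of_int (rs_word N k l \<sigma> x) = (\<Sum>h\<in>H. c h * real_of_int (rs_word N k h \<sigma> x))" for \<sigma> x
  proof -
    have "real_of_int (rs_word N k l \<sigma> x)
        = (\<Sum>j<k. \<Sum>h\<in>H. c h * real_of_int (rs_coeff N k (fst x) j h) * real (\<sigma> (fst x, j, snd x)))"
      unfolding rs_word_def by (simp add: c sum_distrib_right)
    also have "\<dots> = (\<Sum>h\<in>H. \<Sum>j<k. c h * real_of_int (rs_coeff N k (fst x) j h) * real (\<sigma> (fst x, j, snd x)))"
      by (rule sum.swap)
    also have "\<dots> = (\<Sum>h\<in>H. c h * real_of_int (rs_word N k h \<sigma> x))"
      unfolding rs_word_def by (simp add: sum_distrib_left mult.assoc)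
    finally show ?thesis .
  qed
  thus ?thesis by blast
qed

text \<open>The factor \<open>N * N ^ N\<close> is free of \<open>B\<close>, so a coded entry needs
  only a bounded number of letters more than a source symbol.\<close>

lemma abs_rs_word_le:
  assumes "k \<le> N" "l < N" "\<And>j. j < k \<Longrightarrow> \<sigma> (fst x, j, snd x) \<le> B"
  shows "\<bar>rs_word N k l \<sigma> x\<bar> \<le> int (N * N ^ N * B)"
proof -
  have "\<bar>rs_word N k l \<sigma> x\<bar> \<le> (\<Sum>j<k. \<bar>rs_coeff N k (fst x) j l * int (\<sigma> (fst x, j, snd x))\<bar>)"
    unfolding rs_word_def by (rule sum_abs)
  also have "\<dots> \<le> (\<Sum>j<k. int N ^ N * int B)"
    unfolding abs_mult using assms abs_rs_coeff_le[OF assms(1,2)] by (intro sum_mono mult_mono) auto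
  also have "\<dots> = int k * (int N ^ N * int B)" by simp
  also have "\<dots> \<le> int N * (int N ^ N * int B)" using assms(1) by (intro mult_right_mono) auto
  finally show ?thesis by (simp add: mult.assoc)
qed

text \<open>Positive definiteness: \<open>\<Sum>(y - Y l)\<^sup>2\<close> expands into inner products of \<open>y\<close> and of
  \<open>Y l\<close> with the \<open>Y h\<close>, and these agree.\<close>
lemma gram_determines:
  fixes y :: "'a \<Rightarrow> int" and Y :: "'b \<Rightarrow> 'a \<Rightarrow> int"
  assumes J: "finite J" and comb: "\<And>x. x \<in> J \<Longrightarrow> real_of_int (Y l x) = (\<Sum>h\<in>H. c h * real_of_int (Y h x))"
    and norm: "(\<Sum>x\<in>J. y x * y x) = (\<Sum>x\<in>J. Y l x * Y l x)"
    and inner: "\<And>h. h \<in> H \<Longrightarrow> (\<Sum>x\<in>J. y x * Y h x) = (\<Sum>x\<in>J. Y l x * Y h x)"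
    and x: "x \<in> J"
  shows "y x = Y l x"
proof -
  have expand: "(\<Sum>x\<in>J. real_of_int (z x) * real_of_int (Y l x))
      = (\<Sum>h\<in>H. c h * real_of_int (\<Sum>x\<in>J. z x * Y h x))" for z
  proof -
    have "(\<Sum>x\<in>J. real_of_int (z x) * real_of_int (Y l x))
        = (\<Sum>x\<in>J. \<Sum>h\<in>H. c h * (real_of_int (z x) * real_of_int (Y h x)))"
      by (intro sum.cong) (simp_all add: comb sum_distrib_left mult_ac)
    also have "\<dots> = (\<Sum>h\<in>H. \<Sum>x\<in>J. c h * (real_of_int (z x) * real_of_int (Y h x)))"
      by (rule sum.swap)
    also have "\<dots> = (\<Sum>h\<in>H. c h * real_of_int (\<Sum>x\<in>J. z x * Y h x))"
      by (simp add: sum_distrib_left)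
    finally show ?thesis .
  qed
  have "(\<Sum>x\<in>J. real_of_int (y x) * real_of_int (Y l x)) = (\<Sum>x\<in>J. real_of_int (Y l x) * real_of_int (Y l x))"
    unfolding expand using inner by simp
  hence "real_of_int (\<Sum>x\<in>J. y x * Y l x) = real_of_int (\<Sum>x\<in>J. Y l x * Y l x)" by simp
  hence cross: "(\<Sum>x\<in>J. y x * Y l x) = (\<Sum>x\<in>J. Y l x * Y l x)" by (simp only: of_int_eq_iff)
  have "(\<Sum>x\<in>J. (y x - Y l x)\<^sup>2) = (\<Sum>x\<in>J. y x * y x) - 2 * (\<Sum>x\<in>J. y x * Y l x) + (\<Sum>x\<in>J. Y l x * Y l x)"
    by (simp add: power2_eq_square algebra_simps sum.distrib sum_subtractf sum_distrib_left)
  hence "(\<Sum>x\<in>J. (y x - Y l x)\<^sup>2) = 0" using norm cross by simp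
  thus ?thesis using J x by (simp add: sum_nonneg_eq_0_iff)
qed

section \<open>Packets carrying the Gram matrix, and the ambiguity they leave\<close>

definition rs_source :: "nat \<Rightarrow> nat \<Rightarrow> nat \<Rightarrow> (nat \<times> nat \<times> nat) set" where
  "rs_source N k L = {..<N} \<times> {..<k} \<times> {..<L}"

definition rs_gram :: "nat \<Rightarrow> nat \<Rightarrow> nat \<Rightarrow> (nat \<times> nat \<times> nat \<Rightarrow> nat) \<Rightarrow> nat \<times> nat \<Rightarrow> int" where
  "rs_gram N k L \<sigma> = (\<lambda>(l, l')\<in>{..<N} \<times> {..<N}.
     \<Sum>x\<in>{..<N} \<times> {..<L}. rs_word N k l \<sigma> x * rs_word N k l' \<sigma> x)"

text \<open>Both components are restricted functions, so that packets are equal once they agree on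
  the index sets, and only finitely many of them occur for bounded symbols.\<close>

definition rs_packet :: "nat \<Rightarrow> nat \<Rightarrow> nat \<Rightarrow> nat \<Rightarrow> (nat \<times> nat \<times> nat \<Rightarrow> nat) \<Rightarrow>
    (nat \<times> nat \<Rightarrow> int) \<times> (nat \<times> nat \<Rightarrow> int)" where
  "rs_packet N k L l \<sigma> = (restrict (rs_word N k l \<sigma>) ({..<N} \<times> {..<L}), rs_gram N k L \<sigma>)"

lemma rs_packet_eqD:
  assumes "rs_packet N k L l \<sigma> = rs_packet N k L l \<sigma>'" "i < N" "q < L"
  shows "rs_word N k l \<sigma> (i, q) = rs_word N k l \<sigma>' (i, q)"
proof -
  have "restrict (rs_word N k l \<sigma>) ({..<N} \<times> {..<L}) (i, q) = restrict (rs_word N k l \<sigma>') ({..<N} \<times> {..<L}) (i, q)"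
    using assms(1) unfolding rs_packet_def by simp
  thus ?thesis using assms(2,3) by simp
qed

text \<open>Interpolation from \<open>H\<close> recovers the words of every packet, in particular
  those in which a source symbol stands alone up to a nonzero factor.\<close>

lemma rs_packets_determine:
  assumes k: "0 < k" "k \<le> N" and H: "k \<le> card H" "finite H"
    and eq: "\<And>h. h \<in> H \<Longrightarrow> rs_packet N k L h \<sigma> = rs_packet N k L h \<sigma>'"
    and \<sigma>: "\<sigma> \<in> rs_source N k L \<rightarrow>\<^sub>E A" "\<sigma>' \<in> rs_source N k L \<rightarrow>\<^sub>E A"
  shows "\<sigma> = \<sigma>'"
proof (rule PiE_ext[OF \<sigma>])
  fix s assume "s \<in> rs_source N k L"
  then obtain i j q where s: "s = (i, j, q)" "i < N" "j < k" "q < L" unfolding rs_source_def by auto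
  let ?l = "(i + j) mod N"
  obtain c where c: "\<And>\<sigma> x. real_of_int (rs_word N k ?l \<sigma> x) = (\<Sum>h\<in>H. c h * real_of_int (rs_word N k h \<sigma> x))"
    using rs_word_interpolate[OF H(2,1) k(1)] by blast
  have "real_of_int (rs_word N k ?l \<sigma> (i, q)) = real_of_int (rs_word N k ?l \<sigma>' (i, q))"
    unfolding c using rs_packet_eqD[OF eq s(2,4)] by simp
  hence "rs_word N k ?l \<sigma> (i, q) = rs_word N k ?l \<sigma>' (i, q)" by (simp only: of_int_eq_iff)
  from rs_word_systematic_eq[OF k(2) s(3) this] show "\<sigma> s = \<sigma>' s" using s(1) by simp
qed

text \<open>Two candidates each agree with the received word in at least \<open>N - T\<close>
  packets, hence with each other in at least \<open>N - 2 * T = k\<close> packets, which determine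
  the source.\<close>

lemma rs_robust_exact:
  assumes T: "2 * T < N"
  defines "k \<equiv> N - 2 * T"
  shows "robust N T (rs_source N k L \<rightarrow>\<^sub>E A) (rs_packet N k L) (rs_source N k L) (\<lambda>\<sigma> i. \<sigma> i) 0"
proof -
  let ?S = "rs_source N k L \<rightarrow>\<^sub>E A"
  have k: "0 < k" "k \<le> N" using T unfolding k_def by auto
  have unique: "\<sigma>' = \<sigma>" if "\<sigma> \<in> plausible N T ?S (rs_packet N k L) c" "\<sigma>' \<in> plausible N T ?S (rs_packet N k L) c" for \<sigma> \<sigma>' c
  proof -
    let ?H = "\<lambda>\<sigma>. {l. l < N \<and> rs_packet N k L l \<sigma> = c l}"
    have s: "\<sigma> \<in> ?S" "\<sigma>' \<in> ?S" and large: "N \<le> card (?H \<sigma>) + T" "N \<le> card (?H \<sigma>') + T"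
      using that unfolding plausible_def by auto
    have "card (?H \<sigma>) + card (?H \<sigma>') = card (?H \<sigma> \<union> ?H \<sigma>') + card (?H \<sigma> \<inter> ?H \<sigma>')"
      by (rule card_Un_Int) auto
    moreover have "card (?H \<sigma> \<union> ?H \<sigma>') \<le> card {..<N}" by (intro card_mono) auto
    ultimately have "k \<le> card (?H \<sigma> \<inter> ?H \<sigma>')" using large unfolding k_def card_lessThan by linarith
    thus ?thesis by (intro rs_packets_determine[OF k _ _ _ s(2,1)]) auto
  qed
  have "\<sigma>' = \<sigma>" if "\<sigma> \<in> ?S" "\<sigma>' \<in> ?S" "\<sigma>' \<in> plausible N T ?S (rs_packet N k L) (\<lambda>l. rs_packet N k L l \<sigma>)" for \<sigma> \<sigma>'
    using that unique[of \<sigma> "\<lambda>l. rs_packet N k L l \<sigma>" \<sigma>'] by (simp add: plausible_def)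
  moreover have "card {i \<in> rs_source N k L. \<exists>\<sigma>'\<in>plausible N T ?S (rs_packet N k L) c. \<sigma>' i \<noteq> \<sigma> i} \<le> 0"
    if "\<sigma> \<in> plausible N T ?S (rs_packet N k L) c" for c \<sigma>
  proof -
    have "{i \<in> rs_source N k L. \<exists>\<sigma>'\<in>plausible N T ?S (rs_packet N k L) c. \<sigma>' i \<noteq> \<sigma> i} = {}"
      using unique[OF that] by blast
    thus ?thesis by (simp only: card.empty)
  qed
  ultimately show ?thesis by (rule robustI)
qed

text \<open>The systematic packet of an ambiguous symbol lies outside some candidate's agreement
  set. These sets are maximal cliques of the relation \<open>R\<close> below, so few packets are
  concerned, and shifting the windows cyclically makes each packet systematic for only
  \<open>k * L\<close> symbols.\<close>

lemma rs_robust_erasure: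
  assumes T: "2 * T < N"
  defines "k \<equiv> N - T"
  shows "robust N T (rs_source N k L \<rightarrow>\<^sub>E A) (rs_packet N k L) (rs_source N k L) (\<lambda>\<sigma> i. \<sigma> i)
           ((T + T\<^sup>2 div 4 + 1) * (k * L))"
proof -
  let ?S = "rs_source N k L \<rightarrow>\<^sub>E A" and ?J = "{..<N} \<times> {..<L}"
  let ?P = "plausible N T ?S (rs_packet N k L)"
  have k: "0 < k" "k \<le> N" using T unfolding k_def by auto
  have "\<sigma>' = \<sigma>" if s: "\<sigma> \<in> ?S" "\<sigma>' \<in> ?S" and p: "\<sigma>' \<in> ?P (\<lambda>l. rs_packet N k L l \<sigma>)" for \<sigma> \<sigma>'
  proof -
    have "k \<le> card {l. l < N \<and> rs_packet N k L l \<sigma>' = rs_packet N k L l \<sigma>}"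
      using p unfolding plausible_def k_def by auto
    thus ?thesis by (rule rs_packets_determine[OF k _ _ _ s(2,1)]) auto
  qed
  moreover have "card {i \<in> rs_source N k L. \<exists>\<sigma>'\<in>?P c. \<sigma>' i \<noteq> \<sigma> i} \<le> (T + T\<^sup>2 div 4 + 1) * (k * L)"
    if \<sigma>: "\<sigma> \<in> ?P c" for c \<sigma>
  proof -
    let ?H = "\<lambda>\<sigma>. {l. l < N \<and> rs_packet N k L l \<sigma> = c l}"
    define F where "F = ?H ` ?P c"
    define \<Gamma> where "\<Gamma> = rs_gram N k L \<sigma>"
    \<comment> \<open>Both index orders appear so that \<open>R\<close> is symmetric by
      construction. \<open>R v v\<close> says that the received packet \<open>v\<close> has the
      right domain, the common Gram matrix and the prescribed norm.\<close>
    define R where "R l l' \<longleftrightarrow> fst (c l) \<in> extensional ?J \<and> fst (c l') \<in> extensional ?J \<and> snd (c l) = \<Gamma> \<and> snd (c l') = \<Gamma> \<and>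
      (\<Sum>x\<in>?J. fst (c l) x * fst (c l') x) = \<Gamma> (l, l') \<and> (\<Sum>x\<in>?J. fst (c l) x * fst (c l') x) = \<Gamma> (l', l)" for l l'
    have large: "N \<le> card (?H \<sigma>') + T" if "\<sigma>' \<in> ?P c" for \<sigma>' using that unfolding plausible_def by auto
    \<comment> \<open>Two agreement sets of size at least \<open>N - T\<close> meet because
      \<open>2 * T < N\<close>, and a shared packet contains the Gram matrix.\<close>
    have gram: "rs_gram N k L \<sigma>' = \<Gamma>" if "\<sigma>' \<in> ?P c" for \<sigma>'
    proof -
      have "card (?H \<sigma>) + card (?H \<sigma>') = card (?H \<sigma> \<union> ?H \<sigma>') + card (?H \<sigma> \<inter> ?H \<sigma>')"
        by (rule card_Un_Int) auto
      moreover have "card (?H \<sigma> \<union> ?H \<sigma>') \<le> card {..<N}" by (intro card_mono) auto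
      ultimately have "card (?H \<sigma> \<inter> ?H \<sigma>') > 0" using large[OF \<sigma>] large[OF that] T unfolding card_lessThan by linarith
      then obtain l where "rs_packet N k L l \<sigma> = c l" "rs_packet N k L l \<sigma>' = c l"
        by (auto simp: card_gt_0_iff)
      thus ?thesis unfolding rs_packet_def \<Gamma>_def by (metis snd_conv)
    qed
    have c: "c l = (restrict (rs_word N k l \<sigma>') ?J, rs_gram N k L \<sigma>')" if "l \<in> ?H \<sigma>'" for l \<sigma>'
      using that unfolding rs_packet_def by simp
    have fst_c: "fst (c l) x = rs_word N k l \<sigma>' x" if "l \<in> ?H \<sigma>'" "x \<in> ?J" for l \<sigma>' x
      unfolding c[OF that(1)] fst_conv using that(2) by (rule restrict_apply')
    have snd_c: "snd (c l) = \<Gamma>" if "l \<in> ?H \<sigma>'" "\<sigma>' \<in> ?P c" for l \<sigma>'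
      unfolding c[OF that(1)] snd_conv by (rule gram[OF that(2)])
    have ext_c: "fst (c l) \<in> extensional ?J" if "l \<in> ?H \<sigma>'" for l \<sigma>'
      unfolding c[OF that] fst_conv by (rule restrict_extensional)
    have \<Gamma>: "\<Gamma> (l, l') = (\<Sum>x\<in>?J. rs_word N k l \<sigma>' x * rs_word N k l' \<sigma>' x)"
      if "\<sigma>' \<in> ?P c" "l < N" "l' < N" for \<sigma>' l l'
      unfolding gram[OF that(1), symmetric] rs_gram_def using that by simp
    have "card ({..<N} - \<Inter>F) \<le> T + T\<^sup>2 div 4 + 1"
    proof (rule card_complement_Inter_max_cliques[where R = R])
      show "R b a" if "R a b" for a b using that unfolding R_def by (simp add: mult.commute)
      show "H \<subseteq> {..<N}" if "H \<in> F" for H using that unfolding F_def by auto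
      show "card {..<N} \<le> card H + T" if "H \<in> F" for H using that large unfolding F_def by auto
      show "R a b" if H: "H \<in> F" "a \<in> H" "b \<in> H" for H a b
      proof -
        obtain \<sigma>' where s: "\<sigma>' \<in> ?P c" "H = ?H \<sigma>'" using H(1) unfolding F_def by blast
        have "(\<Sum>x\<in>?J. fst (c a) x * fst (c b) x) = (\<Sum>x\<in>?J. rs_word N k a \<sigma>' x * rs_word N k b \<sigma>' x)"
          using fst_c H(2,3) unfolding s(2) by (intro sum.cong) auto
        thus ?thesis
          using snd_c[OF _ s(1)] ext_c[of a \<sigma>'] ext_c[of b \<sigma>'] H(2,3) \<Gamma>[OF s(1)] unfolding R_def s(2) by (simp add: mult.commute)
      qed
      \<comment> \<open>Maximality: the packets in \<open>H\<close> span the word that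
        \<open>\<sigma>'\<close> has in packet \<open>v\<close>, so matching inner products with
        them and a matching norm force the received packet to be that word.\<close>
      show "v \<in> H" if H: "H \<in> F" and v: "v \<in> {..<N}" "R v v" "\<And>h. h \<in> H \<Longrightarrow> R v h" for H v
      proof -
        obtain \<sigma>' where s: "\<sigma>' \<in> ?P c" "H = ?H \<sigma>'" using H(1) unfolding F_def by blast
        have kH: "k \<le> card H" using large[OF s(1)] unfolding s(2) k_def by simp
        have finH: "finite H" unfolding s(2) by simp
        obtain a where a: "\<And>\<sigma> x. real_of_int (rs_word N k v \<sigma> x) = (\<Sum>h\<in>H. a h * real_of_int (rs_word N k h \<sigma> x))"
          using rs_word_interpolate[OF finH kH k(1)] by blast
        have eq: "fst (c v) x = rs_word N k v \<sigma>' x" if "x \<in> ?J" for x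
        proof (rule gram_determines[where J = ?J and H = H and c = a and Y = "\<lambda>l. rs_word N k l \<sigma>'"])
          show "(\<Sum>x\<in>?J. fst (c v) x * fst (c v) x) = (\<Sum>x\<in>?J. rs_word N k v \<sigma>' x * rs_word N k v \<sigma>' x)"
            using v(1,2) \<Gamma>[OF s(1), of v v] unfolding R_def by simp
          show "(\<Sum>x\<in>?J. fst (c v) x * rs_word N k h \<sigma>' x) = (\<Sum>x\<in>?J. rs_word N k v \<sigma>' x * rs_word N k h \<sigma>' x)"
            if h: "h \<in> H" for h
          proof -
            have "(\<Sum>x\<in>?J. fst (c v) x * rs_word N k h \<sigma>' x) = (\<Sum>x\<in>?J. fst (c v) x * fst (c h) x)"
              using fst_c h unfolding s(2) by (intro sum.cong) auto
            also have "\<dots> = \<Gamma> (v, h)" using v(3)[OF h] unfolding R_def by simp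
            finally show ?thesis using \<Gamma>[OF s(1), of v h] v(1) h unfolding s(2) by simp
          qed
        qed (use a that in auto)

        have "fst (c v) = restrict (rs_word N k v \<sigma>') ?J"
        proof (rule extensionalityI)
          show "fst (c v) \<in> extensional ?J" using v(2) unfolding R_def by simp
          show "fst (c v) x = restrict (rs_word N k v \<sigma>') ?J x" if "x \<in> ?J" for x
            using eq[OF that] that by simp
        qed simp
        moreover have "snd (c v) = rs_gram N k L \<sigma>'" using v(2) gram[OF s(1)] unfolding R_def by simp
        ultimately have "rs_packet N k L v \<sigma>' = c v" unfolding rs_packet_def by (metis prod.collapse)
        thus ?thesis using v(1) unfolding s(2) by simp
      qed
      show "?H \<sigma> \<in> F" using \<sigma> unfolding F_def by blast
    qed simp
    hence Z: "card ({..<N} - \<Inter>F) \<le> T + T\<^sup>2 div 4 + 1" .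
    let ?E = "{i \<in> rs_source N k L. \<exists>\<sigma>'\<in>?P c. \<sigma>' i \<noteq> \<sigma> i}"
    \<comment> \<open>Each symbol goes to its systematic packet. For fixed \<open>j\<close> the
      shift by \<open>j\<close> is injective modulo \<open>N\<close>, which is
      \<open>mod_add_neq\<close> with the roles of layer and slot exchanged.\<close>
    let ?g = "\<lambda>(i, j, q). ((i + j) mod N, j, q)"
    have "card ?E \<le> card (({..<N} - \<Inter>F) \<times> {..<k} \<times> {..<L})"
    proof (rule card_inj_on_le)
      show "inj_on ?g ?E"
      proof (rule inj_onI)
        fix s s' assume s: "s \<in> ?E" "s' \<in> ?E" and eq: "?g s = ?g s'"
        obtain i j q where s1: "s = (i, j, q)" "i < N" using s(1) unfolding rs_source_def by auto
        obtain i' j' q' where s2: "s' = (i', j', q')" "i' < N" using s(2) unfolding rs_source_def by auto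
        have "j' = j" "q' = q" "(j + i) mod N = (j + i') mod N" using eq s1 s2 by (auto simp: add.commute)
        moreover from this have "i = i'" using mod_add_neq[OF s1(2) s2(2)] by blast
        ultimately show "s = s'" using s1 s2 by simp
      qed
      show "?g ` ?E \<subseteq> ({..<N} - \<Inter>F) \<times> {..<k} \<times> {..<L}"
      proof (rule image_subsetI)
        fix s assume s: "s \<in> ?E"
        then obtain \<sigma>' where \<sigma>': "\<sigma>' \<in> ?P c" "\<sigma>' s \<noteq> \<sigma> s" by blast
        obtain i j q where ijq: "s = (i, j, q)" "i < N" "j < k" "q < L" using s unfolding rs_source_def by auto
        have "(i + j) mod N \<notin> \<Inter>F"
        proof
          assume "(i + j) mod N \<in> \<Inter>F"
          hence "(i + j) mod N \<in> ?H \<sigma>" "(i + j) mod N \<in> ?H \<sigma>'" using \<sigma> \<sigma>'(1) unfolding F_def by blast+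
          hence "rs_packet N k L ((i + j) mod N) \<sigma>' = rs_packet N k L ((i + j) mod N) \<sigma>" by simp
          from rs_word_systematic_eq[OF k(2) ijq(3) rs_packet_eqD[OF this ijq(2,4)]]
          show False using \<sigma>'(2) ijq(1) by simp
        qed
        thus "?g s \<in> ({..<N} - \<Inter>F) \<times> {..<k} \<times> {..<L}" using ijq by simp
      qed
    qed simp
    also have "\<dots> = card ({..<N} - \<Inter>F) * (k * L)" by (simp add: card_cartesian_product)
    also have "\<dots> \<le> (T + T\<^sup>2 div 4 + 1) * (k * L)" using Z by (rule mult_le_mono1)
    finally show ?thesis .
  qed
  ultimately show ?thesis by (rule robustI)
qed

section \<open>Codes over strings and their rate\<close>

lemma finite_strs: "finite (strs K n)"
  unfolding strs_def using finite_lists_length_eq[of "{1..K}" n] by (simp add: conj_commute)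

lemma card_strs: "card (strs K n) = K ^ n"
  unfolding strs_def using card_lists_length_eq[of "{1..K}" n] by (simp add: conj_commute)

lemma length_strs: "x \<in> strs K n \<Longrightarrow> length x = n"
  by (simp add: strs_def)

text \<open>Blocklength 0 is allowed, in contrast to \<open>is_code\<close>, so that repetition can
  start from the empty code.\<close>

definition robust_code :: "nat \<Rightarrow> nat \<Rightarrow> nat \<Rightarrow> nat \<Rightarrow> nat \<Rightarrow> nat \<Rightarrow> bool" where
  "robust_code K N T n m e \<longleftrightarrow> (\<exists>f. (\<forall>l<N. \<forall>x\<in>strs K n. f l x \<in> strs K m) \<and>
      robust N T (strs K n) f {..<n} (!) e)"

text \<open>Each symbol below \<open>K ^ b\<close> is written as a block of \<open>b\<close>
  letters, and packets are embedded injectively into strings of length \<open>m\<close>. Strings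
  that differ at a letter differ in its block, so an ambiguous symbol accounts for at most
  \<open>b\<close> ambiguous letters.\<close>

lemma robust_code_transport:
  fixes I :: "'i set" and Q :: "'p set"
  assumes I: "finite I" and Q: "finite Q" "card Q \<le> K ^ m"
    and f: "\<And>l \<sigma>. l < N \<Longrightarrow> \<sigma> \<in> I \<rightarrow>\<^sub>E {..<K ^ b} \<Longrightarrow> f l \<sigma> \<in> Q"
    and r: "robust N T (I \<rightarrow>\<^sub>E {..<K ^ b}) f I (\<lambda>\<sigma> i. \<sigma> i) e"
  shows "robust_code K N T (card I * b) m (e * b)"
proof -
  let ?n = "card I * b" and ?S = "I \<rightarrow>\<^sub>E {..<K ^ b}"
  let ?X = "strs K ?n"
  obtain h where h: "bij_betw h {0..<card I} I" using ex_bij_betw_nat_finite[OF I] by blast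
  obtain \<beta> where \<beta>: "bij_betw \<beta> (strs K b) {..<K ^ b}"
    using finite_same_card_bij[of "strs K b" "{..<K ^ b}"] by (auto simp: finite_strs card_strs)
  obtain \<phi> where \<phi>: "inj_on \<phi> Q" "\<phi> ` Q \<subseteq> strs K m"
    using card_le_inj[OF Q(1) finite_strs[of K m]] Q(2) by (auto simp: card_strs)
  define blk where "blk x r = take b (drop (r * b) x)" for x :: "nat list" and r
  define h' where "h' = inv_into {0..<card I} h"
  define S where "S x = (\<lambda>i\<in>I. \<beta> (blk x (h' i)))" for x
  have h'_less: "h' i < card I" if "i \<in> I" for i
    using that bij_betw_inv_into[OF h] unfolding h'_def bij_betw_def by auto
  have h'_h: "h' (h r) = r" if "r < card I" for r
    using that h unfolding h'_def bij_betw_def by (simp add: inv_into_f_f)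
  have h_mem: "h r \<in> I" if "r < card I" for r
    using that h unfolding bij_betw_def by auto
  have blk: "blk x r \<in> strs K b" if x: "x \<in> ?X" and r: "r < card I" for x r
  proof -
    have "Suc r * b \<le> ?n" using r by (intro mult_le_mono1) simp
    hence "length (blk x r) = b" using length_strs[OF x] unfolding blk_def by simp
    moreover have "set (blk x r) \<subseteq> set x" unfolding blk_def by (meson order_trans set_drop_subset set_take_subset)
    ultimately show ?thesis using x unfolding strs_def by auto
  qed
  have S: "S \<in> ?X \<rightarrow> ?S"
  proof
    fix x assume x: "x \<in> ?X"
    have "\<beta> (blk x (h' i)) \<in> {..<K ^ b}" if "i \<in> I" for i
      using bij_betwE[OF \<beta>] blk[OF x h'_less[OF that]] by blast
    thus "S x \<in> ?S" unfolding S_def by (simp add: restrict_PiE_iff)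
  qed
  \<comment> \<open>The existence of a position \<open>p\<close> already forces
    \<open>b > 0\<close>, so \<open>b = 0\<close> needs no separate treatment.\<close>
  have S_neq: "b > 0 \<and> p div b < card I \<and> S x' (h (p div b)) \<noteq> S x (h (p div b))"
    if x: "x \<in> ?X" "x' \<in> ?X" and p: "p < ?n" "x' ! p \<noteq> x ! p" for x x' p
  proof -
    have b: "b > 0" using p by (cases b) auto
    have r: "p div b < card I" using p by (simp add: less_mult_imp_div_less)
    have nth: "blk z (p div b) ! (p mod b) = z ! p" if "z \<in> ?X" for z
    proof -
      have "p div b * b \<le> length z"
        using length_strs[OF that] p(1) div_times_less_eq_dividend[of p b] by linarith
      from nth_drop[OF this, of "p mod b"] show ?thesis using b unfolding blk_def by simp
    qed
    have "blk x' (p div b) \<noteq> blk x (p div b)" using nth[OF x(1)] nth[OF x(2)] p(2) by auto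
    hence "\<beta> (blk x' (p div b)) \<noteq> \<beta> (blk x (p div b))"
      using \<beta> blk[OF x(1) r] blk[OF x(2) r] unfolding bij_betw_def inj_on_def by blast
    thus ?thesis using b r h_mem[OF r] h'_h[OF r] unfolding S_def by simp
  qed
  define f' where "f' l x = \<phi> (f l (S x))" for l x
  have f': "f' l x \<in> strs K m" if "l < N" "x \<in> ?X" for l x
    using \<phi>(2) f[OF that(1) funcset_mem[OF S that(2)]] unfolding f'_def by blast
  \<comment> \<open>A received string outside the image of \<open>\<phi>\<close> gets an arbitrary
    value of \<open>inv_into\<close>. This is harmless, since agreements have to be carried in one
    direction only.\<close>
  have plaus: "S x \<in> plausible N T ?S f (\<lambda>l. inv_into Q \<phi> (c l))"
    if "x \<in> plausible N T ?X f' c" for x c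
  proof (rule plausible_mono[OF S _ that])
    fix l x assume "l < N" "x \<in> ?X" "f' l x = c l"
    thus "f l (S x) = inv_into Q \<phi> (c l)"
      using inv_into_f_f[OF \<phi>(1) f[OF _ funcset_mem[OF S]]] unfolding f'_def by metis
  qed
  have "x' = x" if x: "x \<in> ?X" "x' \<in> ?X" and x': "x' \<in> plausible N T ?X f' (\<lambda>l. f' l x)" for x x'
  proof -
    have "S x' \<in> plausible N T ?S f (\<lambda>l. f l (S x))"
    proof (rule plausible_mono[OF S _ x'])
      fix l z assume "l < N" "z \<in> ?X" "f' l z = f' l x"
      thus "f l (S z) = f l (S x)"
        using inj_onD[OF \<phi>(1)] f[OF _ funcset_mem[OF S]] x(1) unfolding f'_def by blast
    qed
    hence eq: "S x' = S x" by (rule robust_unique[OF r funcset_mem[OF S x(1)]])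
    show "x' = x"
    proof (rule nth_equalityI)
      show "length x' = length x" using x length_strs by metis
      show "x' ! p = x ! p" if "p < length x'" for p
        using S_neq[OF x, of p] eq that length_strs[OF x(2)] by metis
    qed
  qed
  moreover have "card {p\<in>{..<?n}. \<exists>x'\<in>plausible N T ?X f' c. x' ! p \<noteq> x ! p} \<le> e * b"
    if x: "x \<in> plausible N T ?X f' c" for c x
  proof -
    let ?A = "{p\<in>{..<?n}. \<exists>x'\<in>plausible N T ?X f' c. x' ! p \<noteq> x ! p}"
    let ?P = "plausible N T ?S f (\<lambda>l. inv_into Q \<phi> (c l))"
    let ?E = "{i\<in>I. \<exists>\<sigma>\<in>?P. \<sigma> i \<noteq> S x i}"
    let ?g = "\<lambda>p. (h (p div b), p mod b)"
    have X: "z \<in> ?X" if "z \<in> plausible N T ?X f' c" for z using that unfolding plausible_def by blast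
    have A: "b > 0 \<and> p div b < card I \<and> h (p div b) \<in> ?E" if p: "p \<in> ?A" for p
    proof -
      obtain x' where x': "x' \<in> plausible N T ?X f' c" "x' ! p \<noteq> x ! p" "p < ?n" using p by blast
      show ?thesis
        using S_neq[OF X[OF x] X[OF x'(1)] x'(3,2)] plaus[OF x'(1)] h_mem by blast
    qed
    have "card ?A \<le> card (?E \<times> {..<b})"
    proof (rule card_inj_on_le)
      show "inj_on ?g ?A"
      proof (rule inj_onI)
        fix p p' assume p: "p \<in> ?A" "p' \<in> ?A" and eq: "?g p = ?g p'"
        have "p div b = p' div b" using eq A[OF p(1)] A[OF p(2)] h'_h by (metis prod.inject)
        moreover have "p mod b = p' mod b" using eq by simp
        ultimately show "p = p'" by (metis div_mult_mod_eq)
      qed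
      show "?g ` ?A \<subseteq> ?E \<times> {..<b}" using A by (intro image_subsetI) simp
    qed (use I in simp)
    also have "\<dots> \<le> e * b"
      using robust_ambiguous[OF r plaus[OF x]] by (simp add: card_cartesian_product)
    finally show ?thesis .
  qed
  ultimately have "robust N T ?X f' {..<?n} (!) (e * b)" by (rule robustI)
  thus ?thesis unfolding robust_code_def using f' by blast
qed

section \<open>Number of packets and rate\<close>

definition rs_packets :: "nat \<Rightarrow> nat \<Rightarrow> nat \<Rightarrow> ((nat \<times> nat \<Rightarrow> int) \<times> (nat \<times> nat \<Rightarrow> int)) set" where
  "rs_packets N L M = ({..<N} \<times> {..<L} \<rightarrow>\<^sub>E {- int M..int M}) \<times>
     ({..<N} \<times> {..<N} \<rightarrow>\<^sub>E {- int (N * L * M\<^sup>2)..int (N * L * M\<^sup>2)})"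

lemma finite_rs_packets: "finite (rs_packets N L M)"
  unfolding rs_packets_def by (auto intro!: finite_PiE)

lemma card_rs_packets:
  "card (rs_packets N L M) = (2 * M + 1) ^ (N * L) * (2 * (N * L * M\<^sup>2) + 1) ^ N\<^sup>2"
proof -
  have "card {- int G..int G} = 2 * G + 1" for G by simp
  thus ?thesis
    unfolding rs_packets_def by (simp only: card_cartesian_product card_PiE finite_cartesian_product
        finite_lessThan prod_constant card_lessThan power2_eq_square)
qed

lemma rs_packet_in_rs_packets:
  assumes "k \<le> N" "l < N" and \<sigma>: "\<sigma> \<in> rs_source N k L \<rightarrow>\<^sub>E {..<B}"
  shows "rs_packet N k L l \<sigma> \<in> rs_packets N L (N * N ^ N * B)"
proof -
  define M where "M = N * N ^ N * B"
  let ?J = "{..<N} \<times> {..<L}"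
  have word: "\<bar>rs_word N k l \<sigma> x\<bar> \<le> int M" if "x \<in> ?J" "l < N" for x l
    unfolding M_def using assms(1) that(2)
  proof (rule abs_rs_word_le)
    fix j assume "j < k"
    hence "(fst x, j, snd x) \<in> rs_source N k L" using that unfolding rs_source_def by auto
    from PiE_mem[OF \<sigma> this] show "\<sigma> (fst x, j, snd x) \<le> B" by simp
  qed
  have mem_interval: "z \<in> {- G..G} \<longleftrightarrow> \<bar>z\<bar> \<le> G" for z G :: int by auto
  have "\<bar>\<Sum>x\<in>?J. rs_word N k l \<sigma> x * rs_word N k l' \<sigma> x\<bar> \<le> int (N * L * M\<^sup>2)"
    if "l < N" "l' < N" for l l'
  proof -
    have "\<bar>\<Sum>x\<in>?J. rs_word N k l \<sigma> x * rs_word N k l' \<sigma> x\<bar>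
        \<le> (\<Sum>x\<in>?J. \<bar>rs_word N k l \<sigma> x\<bar> * \<bar>rs_word N k l' \<sigma> x\<bar>)"
      unfolding abs_mult[symmetric] by (rule sum_abs)
    also have "\<dots> \<le> (\<Sum>x\<in>?J. int M * int M)"
      using word that by (intro sum_mono mult_mono) auto
    also have "\<dots> = int (N * L * M\<^sup>2)" by (simp add: card_cartesian_product power2_eq_square)
    finally show ?thesis .
  qed
  hence gram: "rs_gram N k L \<sigma> \<in> {..<N} \<times> {..<N} \<rightarrow>\<^sub>E {- int (N * L * M\<^sup>2)..int (N * L * M\<^sup>2)}"
    unfolding rs_gram_def restrict_PiE_iff by (auto simp only: mem_interval mem_Sigma_iff lessThan_iff split: prod.splits)
  have "restrict (rs_word N k l \<sigma>) ?J \<in> ?J \<rightarrow>\<^sub>E {- int M..int M}"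
    unfolding restrict_PiE_iff using word[OF _ assms(2)] by (force simp: abs_le_iff)
  thus ?thesis using gram unfolding rs_packets_def rs_packet_def M_def[symmetric] by blast
qed

text \<open>Only \<open>N * b * b\<close> is quadratic in \<open>b\<close>: each of the
  \<open>N * b\<close> word entries costs \<open>b + c\<close> letters, and each of the
  \<open>N\<^sup>2\<close> Gram entries, polynomially bounded in \<open>K ^ b\<close>, costs
  \<open>3 * b + c\<close>. The term \<open>c\<close> absorbs the constant factors.\<close>

lemma card_rs_packets_le:
  assumes K: "K \<ge> 2" and N: "N \<ge> 1" and C: "C \<ge> 1" and c: "3 * N * C\<^sup>2 \<le> K ^ c"
  shows "card (rs_packets N b (C * K ^ b)) \<le> K ^ (N * b * (b + c) + N\<^sup>2 * (3 * b + c))"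
proof -
  have CC: "C \<le> C\<^sup>2" using C by (simp add: power2_eq_square)
  \<comment> \<open>Bounding the number of columns \<open>b\<close> by \<open>K ^ b\<close> is what
    turns \<open>2 * b\<close> into \<open>3 * b\<close> in the cost of a Gram entry.\<close>
  have b: "b \<le> K ^ b"
  proof -
    have "b < 2 ^ b" by (rule less_exp)
    also have "\<dots> \<le> K ^ b" using K by (rule power_mono) simp
    finally show ?thesis by simp
  qed
  have "1 \<le> C * K ^ b" using C K by (simp add: Suc_le_eq)
  hence "2 * (C * K ^ b) + 1 \<le> 3 * C * K ^ b" by simp
  also have "\<dots> \<le> 3 * N * C\<^sup>2 * K ^ b"
    using CC N by (intro mult_le_mono1) (simp add: mult_le_mono)
  also have "\<dots> \<le> K ^ c * K ^ b" using c by (rule mult_le_mono1)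
  finally have 1: "2 * (C * K ^ b) + 1 \<le> K ^ (b + c)" by (simp add: power_add mult.commute)
  have 2: "2 * (N * b * (C * K ^ b)\<^sup>2) + 1 \<le> K ^ (3 * b + c)"
  proof (cases "b = 0")
    case True
    thus ?thesis using K by simp
  next
    case False
    have "1 \<le> N * b * (C * K ^ b)\<^sup>2" using False N C K by (simp add: Suc_le_eq)
    hence "2 * (N * b * (C * K ^ b)\<^sup>2) + 1 \<le> 3 * (N * b * (C * K ^ b)\<^sup>2)" by linarith
    also have "\<dots> = 3 * N * C\<^sup>2 * (b * (K ^ b)\<^sup>2)" by (simp add: power_mult_distrib)
    also have "\<dots> \<le> K ^ c * (K ^ b * (K ^ b)\<^sup>2)" using c b by (intro mult_le_mono) auto
    also have "\<dots> = K ^ (3 * b + c)"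
      by (simp add: power_add[symmetric] power_mult[symmetric] add.commute)
    finally show ?thesis .
  qed
  have "card (rs_packets N b (C * K ^ b)) \<le> (K ^ (b + c)) ^ (N * b) * (K ^ (3 * b + c)) ^ N\<^sup>2"
    unfolding card_rs_packets using 1 2 by (intro mult_le_mono power_mono) auto
  also have "\<dots> = K ^ (N * b * (b + c) + N\<^sup>2 * (3 * b + c))"
    by (simp only: power_mult[symmetric] power_add[symmetric] mult.commute[of "N * b"] mult.commute[of "N\<^sup>2"])
  finally show ?thesis .
qed

text \<open>Using \<open>b\<close> columns of symbols of \<open>b\<close> letters each gives
  blocklength \<open>N * k * b * b\<close> and packet length \<open>N * b * b + O(b)\<close>, so the
  rate tends to \<open>1 / k\<close>, while the ambiguous fraction \<open>d / N\<close> is the same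
  for all \<open>b\<close>.\<close>

lemma rs_robust_code:
  assumes K: "K \<ge> 2" and k: "0 < k" "k \<le> N" and \<epsilon>: "\<epsilon> > 0"
    and robust: "\<And>L A. robust N T (rs_source N k L \<rightarrow>\<^sub>E A) (rs_packet N k L) (rs_source N k L)
            (\<lambda>\<sigma> i. \<sigma> i) (d * (k * L))"
  shows "\<exists>n m e. n > 0 \<and> robust_code K N T n m e \<and> real m / real n \<le> 1 / real k + \<epsilon> \<and> e * N = d * n"
proof -
  define C where "C = N * N ^ N"
  define c where "c = 3 * N * C\<^sup>2"
  have C: "C \<ge> 1" unfolding C_def using k by (simp add: Suc_le_eq)
  have c: "3 * N * C\<^sup>2 \<le> K ^ c"
  proof -
    have "c < 2 ^ c" by (rule less_exp)
    also have "\<dots> \<le> K ^ c" using K by (rule power_mono) simp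
    finally show ?thesis unfolding c_def by simp
  qed
  \<comment> \<open>\<open>D\<close> gathers the lower-order terms:
    \<open>m \<le> N * b * b + D * b\<close>.\<close>
  define D where "D = N * c + N\<^sup>2 * (3 + c)"
  obtain b :: nat where b: "b > 0" "real D / \<epsilon> < real b"
    using reals_Archimedean2[of "real D / \<epsilon>"] \<epsilon> by (metis divide_nonneg_pos le_less_trans of_nat_0_le_iff of_nat_0_less_iff)
  define n where "n = card (rs_source N k b) * b"
  define m where "m = N * b * (b + c) + N\<^sup>2 * (3 * b + c)"
  have n: "n = N * k * b * b" unfolding n_def rs_source_def by (simp add: card_cartesian_product mult.assoc)
  have "robust_code K N T n m (d * (k * b) * b)"
    unfolding n_def
  proof (rule robust_code_transport[where Q = "rs_packets N b (C * K ^ b)" and f = "rs_packet N k b"])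
    show "card (rs_packets N b (C * K ^ b)) \<le> K ^ m"
      unfolding m_def using card_rs_packets_le[OF K _ C c] k by simp
    show "rs_packet N k b l \<sigma> \<in> rs_packets N b (C * K ^ b)"
      if "l < N" "\<sigma> \<in> rs_source N k b \<rightarrow>\<^sub>E {..<K ^ b}" for l \<sigma>
      unfolding C_def using rs_packet_in_rs_packets[OF k(2) that] .
  qed (use robust finite_rs_packets in \<open>auto simp: rs_source_def\<close>)
  moreover have "n > 0" unfolding n using k b by simp
  moreover have "d * (k * b) * b * N = d * n" unfolding n by (simp add: ac_simps)
  moreover have "real m / real n \<le> 1 / real k + \<epsilon>"
  proof -
    have "m \<le> N * b * b + D * b"
    proof -
      have "N\<^sup>2 * c \<le> N\<^sup>2 * c * b" using b by simp
      thus ?thesis unfolding m_def D_def by (simp add: algebra_simps)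
    qed
    hence "real m \<le> real (N * b * b + D * b)" by (simp only: of_nat_le_iff)
    also have "\<dots> = real N * b * b + real D * b" by simp
    also have "real D * b \<le> \<epsilon> * b * b" using b \<epsilon> by (intro mult_right_mono) (auto simp: field_simps)
    also have "\<epsilon> * b * b \<le> real N * real k * (\<epsilon> * b * b)"
    proof -
      have "1 * 1 \<le> real N * real k" using k by (intro mult_mono) auto
      from mult_right_mono[OF this, of "\<epsilon> * b * b"] show ?thesis using \<epsilon> by simp
    qed
    also have "real N * b * b + real N * real k * (\<epsilon> * b * b) = (1 / real k + \<epsilon>) * real n"
      unfolding n using k by (simp add: field_simps)
    finally show ?thesis using \<open>n > 0\<close> by (simp add: field_simps)
  qed
  ultimately show ?thesis by blast
qed

section \<open>Concatenation of codes\<close>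

lemma robust_code_0: "robust_code K N T 0 0 0"
  unfolding robust_code_def robust_def plausible_def by (auto simp: strs_def)

text \<open>Cutting every received packet after \<open>m1\<close> letters splits a candidate for the
  long code into candidates for the two parts, so ambiguous positions add up.\<close>

lemma robust_code_append:
  assumes "robust_code K N T n1 m1 e1" "robust_code K N T n2 m2 e2"
  shows "robust_code K N T (n1 + n2) (m1 + m2) (e1 + e2)"
proof -
  obtain f1 where f1: "\<And>l x. l < N \<Longrightarrow> x \<in> strs K n1 \<Longrightarrow> f1 l x \<in> strs K m1"
    and r1: "robust N T (strs K n1) f1 {..<n1} (!) e1" using assms unfolding robust_code_def by blast
  obtain f2 where f2: "\<And>l x. l < N \<Longrightarrow> x \<in> strs K n2 \<Longrightarrow> f2 l x \<in> strs K m2"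
    and r2: "robust N T (strs K n2) f2 {..<n2} (!) e2" using assms unfolding robust_code_def by blast
  define f where "f l x = f1 l (take n1 x) @ f2 l (drop n1 x)" for l x
  let ?X = "strs K (n1 + n2)"
  have t: "take n1 \<in> ?X \<rightarrow> strs K n1" and d: "drop n1 \<in> ?X \<rightarrow> strs K n2"
    unfolding strs_def using set_take_subset set_drop_subset by fastforce+
  have f: "f l x \<in> strs K (m1 + m2)" if "l < N" "x \<in> ?X" for l x
  proof -
    have "f1 l (take n1 x) \<in> strs K m1" "f2 l (drop n1 x) \<in> strs K m2" 
      using f1[OF that(1)] f2[OF that(1)] funcset_mem[OF t that(2)] funcset_mem[OF d that(2)] by blast+
    thus ?thesis unfolding f_def strs_def by auto
  qed
  have len1: "length (f1 l (take n1 x)) = m1" if "l < N" "x \<in> ?X" for l x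
    using f1[OF that(1)] that(2) t length_strs by blast
  let ?c1 = "\<lambda>c l. take m1 (c l)" and ?c2 = "\<lambda>c l. drop m1 (c l)"
  have p1: "take n1 x \<in> plausible N T (strs K n1) f1 (?c1 c)" if "x \<in> plausible N T ?X f c" for x c
    using len1 by (intro plausible_mono[OF t _ that]) (metis append_eq_conv_conj f_def)
  have p2: "drop n1 x \<in> plausible N T (strs K n2) f2 (?c2 c)" if "x \<in> plausible N T ?X f c" for x c
    using len1 by (intro plausible_mono[OF d _ that]) (metis append_eq_conv_conj f_def)
  have "x' = x" if x: "x \<in> ?X" and x': "x' \<in> plausible N T ?X f (\<lambda>l. f l x)" for x x'
  proof -
    have c: "x' \<in> ?X" "x' \<in> plausible N T ?X f (\<lambda>l. f l x)" using x' unfolding plausible_def by auto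
    have "take n1 x' \<in> plausible N T (strs K n1) f1 (\<lambda>l. f1 l (take n1 x))"
      using len1[OF _ x] len1
      by (intro plausible_mono[OF t _ c(2)]) (metis append_eq_append_conv f_def)
    hence 1: "take n1 x' = take n1 x" by (rule robust_unique[OF r1 funcset_mem[OF t x]])
    have "drop n1 x' \<in> plausible N T (strs K n2) f2 (\<lambda>l. f2 l (drop n1 x))"
      using len1[OF _ x] len1
      by (intro plausible_mono[OF d _ c(2)]) (metis append_eq_append_conv f_def)
    hence 2: "drop n1 x' = drop n1 x" by (rule robust_unique[OF r2 funcset_mem[OF d x]])
    show ?thesis using 1 2 by (metis append_take_drop_id)
  qed
  moreover have "card {i\<in>{..<n1 + n2}. \<exists>x'\<in>plausible N T ?X f c. x' ! i \<noteq> x ! i} \<le> e1 + e2"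
    if x: "x \<in> plausible N T ?X f c" for c x
  proof -
    let ?A = "{i\<in>{..<n1 + n2}. \<exists>x'\<in>plausible N T ?X f c. x' ! i \<noteq> x ! i}"
    let ?A1 = "{i\<in>{..<n1}. \<exists>x'\<in>plausible N T (strs K n1) f1 (?c1 c). x' ! i \<noteq> take n1 x ! i}"
    let ?A2 = "{i\<in>{..<n2}. \<exists>x'\<in>plausible N T (strs K n2) f2 (?c2 c). x' ! i \<noteq> drop n1 x ! i}"
    have "?A \<subseteq> ?A1 \<union> (+) n1 ` ?A2"
    proof
      fix i assume "i \<in> ?A"
      then obtain x' where i: "i < n1 + n2" and x': "x' \<in> plausible N T ?X f c" and ne: "x' ! i \<noteq> x ! i"
        by blast
      have lx: "length x = n1 + n2" "length x' = n1 + n2"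
        using x x' length_strs unfolding plausible_def by auto
      show "i \<in> ?A1 \<union> (+) n1 ` ?A2"
      proof (cases "i < n1")
        case True
        thus ?thesis using p1[OF x'] ne by (auto intro!: bexI[of _ "take n1 x'"])
      next
        case False
        then obtain j where j: "i = n1 + j" using le_Suc_ex not_less by blast
        have "j \<in> ?A2" using p2[OF x'] ne i lx unfolding j by (auto intro!: bexI[of _ "drop n1 x'"])
        thus ?thesis using j by blast
      qed
    qed
    hence "card ?A \<le> card (?A1 \<union> (+) n1 ` ?A2)" by (intro card_mono) auto
    also have "\<dots> \<le> card ?A1 + card ((+) n1 ` ?A2)" by (rule card_Un_le)
    also have "\<dots> = card ?A1 + card ?A2" by (subst card_image) auto
    also have "\<dots> \<le> e1 + e2"
      using robust_ambiguous[OF r1 p1[OF x]] robust_ambiguous[OF r2 p2[OF x]] by (rule add_mono)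
    finally show ?thesis .
  qed
  ultimately have "robust N T ?X f {..<n1 + n2} (!) (e1 + e2)" by (rule robustI)
  thus ?thesis unfolding robust_code_def using f by blast
qed

lemma robust_code_repeat:
  assumes "robust_code K N T n m e"
  shows "robust_code K N T (q * n) (q * m) (q * e)"
proof (induction q)
  case (Suc q)
  thus ?case using robust_code_append[OF assms Suc] by simp
qed (simp add: robust_code_0)

section \<open>Distortion\<close>

lemma sym_dist_nonneg: "0 \<le> sym_dist x y"
  by (auto simp: sym_dist_def split: option.split)

lemma str_dist_eq_0_iff:
  assumes "length xs > 0"
  shows "str_dist xs ys = 0 \<longleftrightarrow> (\<forall>i<length xs. ys ! i = Some (xs ! i))"
proof -
  have "str_dist xs ys = 0 \<longleftrightarrow> (\<Sum>i<length xs. sym_dist (xs ! i) (ys ! i)) = 0"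
    unfolding str_dist_def using assms by auto
  also have "\<dots> \<longleftrightarrow> (\<forall>i<length xs. sym_dist (xs ! i) (ys ! i) = 0)"
    by (subst sum_nonneg_eq_0_iff) (auto simp: sym_dist_nonneg)
  also have "\<dots> \<longleftrightarrow> (\<forall>i<length xs. ys ! i = Some (xs ! i))"
  proof -
    have "sym_dist x y = 0 \<longleftrightarrow> y = Some x" for x y
      by (auto simp: sym_dist_def split: option.splits)
    thus ?thesis by simp
  qed
  finally show ?thesis .
qed

lemma str_dist_le:
  assumes "length xs > 0" "\<And>i. i < length xs \<Longrightarrow> ys ! i = None \<or> ys ! i = Some (xs ! i)"
    and "card {i. i < length xs \<and> ys ! i = None} \<le> e"
  shows "str_dist xs ys \<le> ereal (real e / real (length xs))"
proof -
  have "(\<Sum>i<length xs. sym_dist (xs ! i) (ys ! i))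
      = (\<Sum>i<length xs. ereal (if ys ! i = None then 1 else 0))"
  proof (rule sum.cong)
    fix i assume "i \<in> {..<length xs}"
    hence "ys ! i = None \<or> ys ! i = Some (xs ! i)" using assms(2) by simp
    thus "sym_dist (xs ! i) (ys ! i) = ereal (if ys ! i = None then 1 else 0)"
      by (auto simp: sym_dist_def)
  qed simp
  also have "\<dots> = ereal (\<Sum>i<length xs. if ys ! i = None then 1 else 0)"
    by (rule sum_ereal)
  also have "(\<Sum>i<length xs. if ys ! i = None then 1 else 0) = real (card {i. i < length xs \<and> ys ! i = None})"
    by (simp add: sum.If_cases) (auto intro!: arg_cong[of _ _ card])
  finally show ?thesis
    unfolding str_dist_def using assms by (simp add: divide_right_mono)
qed

text \<open>The decoder outputs a symbol precisely when all source strings compatible with at most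
  \<open>T\<close> alterations agree on it.\<close>
lemma robust_code_imp_code:
  assumes "robust_code K N T n m e" "n > 0"
  shows "\<exists>f g. is_code K N n m f g \<and> feasible K N n f g \<and>
           D_T K N T n m f g \<le> ereal (real e / real n)"
proof -
  obtain f where f: "\<And>l x. l < N \<Longrightarrow> x \<in> strs K n \<Longrightarrow> f l x \<in> strs K m"
    and r: "robust N T (strs K n) f {..<n} (!) e" using assms unfolding robust_code_def by blast
  define P where "P cs = plausible N T (strs K n) f (\<lambda>l. cs ! l)" for cs
  \<comment> \<open>Nonemptiness is demanded so that a received word without candidates is erased
    everywhere; vacuous agreement would output letters of an arbitrary string.\<close>
  define agree where "agree cs j \<longleftrightarrow> P cs \<noteq> {} \<and> (\<forall>x\<in>P cs. \<forall>x'\<in>P cs. x' ! j = x ! j)" for cs j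
  define g where "g cs = map (\<lambda>j. if agree cs j then Some ((SOME x. x \<in> P cs) ! j) else None) [0..<n]" for cs
  have g_len: "length (g cs) = n" for cs by (simp add: g_def)
  have g_nth: "g cs ! j = (if \<forall>x'\<in>P cs. x' ! j = x ! j then Some (x ! j) else None)"
    if x: "x \<in> P cs" and j: "j < n" for cs j x
  proof -
    have x0: "(SOME x. x \<in> P cs) \<in> P cs" using x by (rule someI)
    have "agree cs j \<longleftrightarrow> (\<forall>x'\<in>P cs. x' ! j = x ! j)"
      unfolding agree_def using x by (metis empty_iff)
    moreover have "g cs ! j = (if agree cs j then Some ((SOME x. x \<in> P cs) ! j) else None)"
      using j by (simp add: g_def)
    ultimately show ?thesis using x0 by (metis (full_types))
  qed
  have PX: "P cs \<subseteq> strs K n" for cs unfolding P_def plausible_def by auto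
  have code: "is_code K N n m f g"
    unfolding is_code_def
  proof (intro conjI allI impI ballI)
    fix cs y assume y: "y \<in> set (g cs)"
    then obtain j where j: "j < n" "y = g cs ! j" using g_len by (metis in_set_conv_nth)
    show "y = None \<or> the y \<in> {1..K}"
    proof (cases "P cs = {}")
      case True
      thus ?thesis using y by (auto simp: g_def agree_def)
    next
      case False
      then obtain x where x: "x \<in> P cs" by blast
      hence "x ! j \<in> {1..K}" using PX[of cs] j(1) unfolding strs_def by (auto dest!: subsetD)
      thus ?thesis using g_nth[OF x j(1)] j by auto
    qed
  qed (use assms f g_len in auto)
  have feas: "feasible K N n f g"
    unfolding feasible_def
  proof
    fix x assume x: "x \<in> strs K n"
    let ?cs = "map (\<lambda>l. f l x) [0..<N]"
    have eq: "{l. l < N \<and> f l z = ?cs ! l} = {l. l < N \<and> f l z = f l x}" for z by auto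
    have P: "P ?cs = plausible N T (strs K n) f (\<lambda>l. f l x)"
      unfolding P_def plausible_def eq ..
    have "x \<in> P ?cs" unfolding P plausible_def using x by simp
    moreover have "x' = x" if "x' \<in> P ?cs" for x'
      using that unfolding P by (rule robust_unique[OF r x])
    ultimately have "P ?cs = {x}" by blast
    hence "g ?cs ! j = Some (x ! j)" if "j < n" for j
      using g_nth[of x ?cs j] that by simp
    thus "str_dist x (g ?cs) = 0"
      using str_dist_eq_0_iff[of x] length_strs[OF x] assms(2) by simp
  qed
  have "D_T K N T n m f g \<le> ereal (real e / real n)"
    unfolding D_T_def
  proof (rule SUP_least, clarify)
    fix x A cs assume x: "x \<in> strs K n" and A: "A \<subseteq> {0..<N}" "card A \<le> T"
      and cs: "cs \<in> altered K N m f x A"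
    \<comment> \<open>The true source \<open>x\<close> stays a candidate, so an output letter is
      never wrong and only ambiguous positions are erased.\<close>
    have "{0..<N} - A \<subseteq> {l. l < N \<and> f l x = cs ! l}" using cs unfolding altered_def by auto
    hence "card ({0..<N} - A) \<le> card {l. l < N \<and> f l x = cs ! l}" by (intro card_mono) auto
    hence xP: "x \<in> P cs"
      unfolding P_def plausible_def using x A by (simp add: card_Diff_subset finite_subset[OF A(1)])
    have "{i. i < length x \<and> g cs ! i = None} \<subseteq> {i\<in>{..<n}. \<exists>x'\<in>P cs. x' ! i \<noteq> x ! i}"
      using g_nth[OF xP] length_strs[OF x] by (auto split: if_splits)
    hence "card {i. i < length x \<and> g cs ! i = None} \<le> card {i\<in>{..<n}. \<exists>x'\<in>P cs. x' ! i \<noteq> x ! i}"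
      by (intro card_mono) auto
    also have "\<dots> \<le> e" using robust_ambiguous[OF r] xP unfolding P_def .
    finally show "str_dist x (g cs) \<le> ereal (real e / real n)"
      using str_dist_le[of x "g cs" e] length_strs[OF x] assms(2) g_nth[OF xP] by auto
  qed
  thus ?thesis using code feas by blast
qed

text \<open>Concatenating copies of the two codes in proportion \<open>u\<close> to
  \<open>q - u\<close>, with \<open>u / q\<close> close to \<open>\<theta>\<close>, mixes rate and
  distortion linearly up to a rounding error of order \<open>1 / q\<close>.\<close>

lemma achievable_time_sharing:
  assumes codes: "\<And>\<epsilon>. \<epsilon> > 0 \<Longrightarrow> \<exists>n m e. n > 0 \<and> robust_code K N T n m e \<and> real m / real n \<le> R1 + \<epsilon> \<and> real e / real n \<le> D1"
      "\<And>\<epsilon>. \<epsilon> > 0 \<Longrightarrow> \<exists>n m e. n > 0 \<and> robust_code K N T n m e \<and> real m / real n \<le> R2 + \<epsilon> \<and> real e / real n \<le> D2"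
    and \<theta>: "0 \<le> \<theta>" "\<theta> \<le> 1"
  shows "achievable K N T (\<theta> * R1 + (1 - \<theta>) * R2) (\<theta> * D1 + (1 - \<theta>) * D2)"
  unfolding achievable_def
proof (intro allI impI)
  fix \<epsilon> :: real assume \<epsilon>: "\<epsilon> > 0"
  obtain n1 m1 e1 where 1: "n1 > 0" "robust_code K N T n1 m1 e1" "real m1 / real n1 \<le> R1 + \<epsilon> / 2" "real e1 / real n1 \<le> D1"
    using codes(1)[of "\<epsilon> / 2"] \<epsilon> by auto
  obtain n2 m2 e2 where 2: "n2 > 0" "robust_code K N T n2 m2 e2" "real m2 / real n2 \<le> R2 + \<epsilon> / 2" "real e2 / real n2 \<le> D2"
    using codes(2)[of "\<epsilon> / 2"] \<epsilon> by auto
  \<comment> \<open>Half of \<open>\<epsilon>\<close> pays for the rates of the component codes, the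
    other half for rounding \<open>\<theta>\<close> to \<open>\<mu>\<close>, which moves a mixture
    by at most \<open>\<Delta> / q\<close>.\<close>
  define \<Delta> where "\<Delta> = \<bar>R2 - R1\<bar> + \<bar>D2 - D1\<bar>"
  obtain q :: nat where q: "q > 0" "2 * \<Delta> / \<epsilon> < real q"
    using reals_Archimedean2[of "2 * \<Delta> / \<epsilon>"] \<epsilon> unfolding \<Delta>_def
    by (metis abs_ge_zero add_nonneg_nonneg divide_nonneg_pos le_less_trans mult_nonneg_nonneg of_nat_0_less_iff zero_le_numeral)
  define u where "u = nat \<lfloor>\<theta> * q\<rfloor>"
  have u: "real u \<le> \<theta> * q" "\<theta> * q < real u + 1" unfolding u_def using \<theta> by auto
  have "\<theta> * q \<le> real q" using mult_right_mono[OF \<theta>(2), of "real q"] by simp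
  hence uq: "u \<le> q" using u(1) by linarith
  define \<mu> where "\<mu> = real u / q"
  have \<mu>: "0 \<le> \<mu>" "\<mu> \<le> 1" unfolding \<mu>_def using uq q by auto
  have near: "\<bar>\<theta> - \<mu>\<bar> \<le> 1 / q"
  proof -
    have "\<theta> - \<mu> = (\<theta> * q - u) / q" unfolding \<mu>_def using q by (simp add: diff_divide_distrib)
    thus ?thesis using u q by (simp add: divide_right_mono)
  qed
  have gap: "1 / q * \<Delta> \<le> \<epsilon> / 2" using q \<epsilon> by (simp add: field_simps)
  have shift: "\<mu> * x + (1 - \<mu>) * y \<le> \<theta> * x + (1 - \<theta>) * y + \<epsilon> / 2" if "\<bar>y - x\<bar> \<le> \<Delta>" for x y
  proof -
    have "\<mu> * x + (1 - \<mu>) * y = \<theta> * x + (1 - \<theta>) * y + (\<theta> - \<mu>) * (y - x)" by (simp add: algebra_simps)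
    also have "(\<theta> - \<mu>) * (y - x) \<le> \<bar>\<theta> - \<mu>\<bar> * \<bar>y - x\<bar>" by (metis abs_ge_self abs_mult)
    also have "\<dots> \<le> 1 / q * \<Delta>" using near that by (intro mult_mono) auto
    finally show ?thesis using gap by linarith
  qed
  \<comment> \<open>The factors \<open>n2\<close> and \<open>n1\<close> bring both codes to the
    common length \<open>n1 * n2\<close>, so that \<open>\<mu>\<close> is the fraction of source
    letters handled by the first code.\<close>
  define n m e where "n = u * n2 * n1 + (q - u) * n1 * n2" and "m = u * n2 * m1 + (q - u) * n1 * m2"
    and "e = u * n2 * e1 + (q - u) * n1 * e2"
  have code: "robust_code K N T n m e"
    unfolding n_def m_def e_def using robust_code_append[OF robust_code_repeat[OF 1(2)] robust_code_repeat[OF 2(2)]] .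
  have n: "n = q * n1 * n2" 
  proof -
    have "n = (u + (q - u)) * n1 * n2" unfolding n_def by (simp only: distrib_left distrib_right mult_ac)
    thus ?thesis using uq by simp
  qed
  have n_pos: "n > 0" unfolding n using q 1 2 by simp
  have mix: "real (u * n2 * x1 + (q - u) * n1 * x2) / real n = \<mu> * (real x1 / n1) + (1 - \<mu>) * (real x2 / n2)" for x1 x2
    unfolding n \<mu>_def using q 1(1) 2(1) uq by (simp add: of_nat_diff field_simps)
  have "real m / real n \<le> \<mu> * (R1 + \<epsilon> / 2) + (1 - \<mu>) * (R2 + \<epsilon> / 2)"
    unfolding m_def mix using 1(3) 2(3) \<mu> by (intro add_mono mult_left_mono) auto
  also have "\<dots> = \<mu> * R1 + (1 - \<mu>) * R2 + \<epsilon> / 2" by (simp add: field_simps)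
  also have "\<dots> \<le> \<theta> * R1 + (1 - \<theta>) * R2 + \<epsilon>" using shift[of R2 R1] unfolding \<Delta>_def by simp
  finally have rate: "real m / real n \<le> \<theta> * R1 + (1 - \<theta>) * R2 + \<epsilon>" .
  have "real e / real n \<le> \<mu> * D1 + (1 - \<mu>) * D2"
    unfolding e_def mix using 1(4) 2(4) \<mu> by (intro add_mono mult_left_mono) auto
  also have "\<dots> \<le> \<theta> * D1 + (1 - \<theta>) * D2 + \<epsilon>" using shift[of D2 D1] \<epsilon> unfolding \<Delta>_def by simp
  finally have dist: "real e / real n \<le> \<theta> * D1 + (1 - \<theta>) * D2 + \<epsilon>" .
  obtain f g where "is_code K N n m f g" "feasible K N n f g" "D_T K N T n m f g \<le> ereal (real e / real n)"
    using robust_code_imp_code[OF code n_pos] by blast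
  thus "\<exists>n m f g. is_code K N n m f g \<and> feasible K N n f g \<and>
      real m / real n \<le> \<theta> * R1 + (1 - \<theta>) * R2 + \<epsilon> \<and>
      D_T K N T n m f g \<le> ereal (\<theta> * D1 + (1 - \<theta>) * D2 + \<epsilon>)"
    using rate dist by (meson ereal_less_eq(3) order_trans)
qed

section \<open>Converse\<close>

lemma str_dist_wrong:
  assumes "i < length xs" "ys ! i = Some z" "z \<noteq> xs ! i"
  shows "str_dist xs ys = \<infinity>"
proof -
  have "sym_dist (xs ! i) (ys ! i) \<le> (\<Sum>i<length xs. sym_dist (xs ! i) (ys ! i))"
    using assms(1) sum_mono2[of "{..<length xs}" "{i}" "\<lambda>i. sym_dist (xs ! i) (ys ! i)"]
    by (simp add: sym_dist_nonneg)
  hence "(\<Sum>i<length xs. sym_dist (xs ! i) (ys ! i)) = \<infinity>"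
    using assms by (simp add: sym_dist_def)
  moreover have "1 / real (length xs) > 0" using assms(1) by auto
  ultimately show ?thesis unfolding str_dist_def by simp
qed

lemma D_T_infinite:
  assumes N: "T \<le> N" and K: "K \<ge> 2" and code: "is_code K N n m f g" and feas: "feasible K N n f g"
    and rate: "m * (N - T) < n"
  shows "D_T K N T n m f g = \<infinity>"
proof -
  have f: "\<And>l x. l < N \<Longrightarrow> x \<in> strs K n \<Longrightarrow> f l x \<in> strs K m" and n: "n > 0"
    using code unfolding is_code_def by auto
  let ?\<phi> = "\<lambda>x. restrict (\<lambda>l. f l x) {..<N - T}"
  \<comment> \<open>Pigeonhole: the first \<open>N - T\<close> packets take at most
    \<open>K ^ (m * (N - T))\<close> values, fewer than the \<open>K ^ n\<close> source
    strings.\<close>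
  have "\<not> inj_on ?\<phi> (strs K n)"
  proof
    assume "inj_on ?\<phi> (strs K n)"
    moreover have "?\<phi> ` strs K n \<subseteq> {..<N - T} \<rightarrow>\<^sub>E strs K m"
      using f by (intro image_subsetI) (simp add: restrict_PiE_iff)
    ultimately have "card (strs K n) \<le> card ({..<N - T} \<rightarrow>\<^sub>E strs K m)"
      by (meson card_inj_on_le finite_PiE finite_lessThan finite_strs)
    hence "K ^ n \<le> K ^ (m * (N - T))" by (simp add: card_strs card_PiE power_mult)
    thus False using rate K by simp
  qed
  then obtain x x' where x: "x \<in> strs K n" "x' \<in> strs K n" "x \<noteq> x'" and eq: "?\<phi> x = ?\<phi> x'"
    unfolding inj_on_def by blast
  obtain i where i: "i < n" "x ! i \<noteq> x' ! i"
    using x length_strs nth_equalityI by metis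
  \<comment> \<open>The intact codeword of \<open>x'\<close> is also a legal alteration of that of
    \<open>x\<close> in the last \<open>T\<close> packets, and feasibility forces the decoder to
    output \<open>x'\<close>.\<close>
  let ?cs = "map (\<lambda>l. f l x') [0..<N]"
  have agree: "f l x = f l x'" if "l < N - T" for l
    using fun_cong[OF eq, of l] that by simp
  have "?cs \<in> altered K N m f x {N - T..<N}"
    unfolding altered_def using f x agree by (auto simp: not_le)
  moreover have "card {N - T..<N} \<le> T" "{N - T..<N} \<subseteq> {0..<N}" by auto
  ultimately have "str_dist x (g ?cs) \<le> D_T K N T n m f g"
    unfolding D_T_def using x
    by (intro SUP_upper2[of "(x, {N - T..<N}, ?cs)"]) auto
  moreover have "g ?cs ! i = Some (x' ! i)"
    using feas x i n str_dist_eq_0_iff[of x' "g ?cs"] length_strs[of x']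
    unfolding feasible_def by auto
  hence "str_dist x (g ?cs) = \<infinity>"
    using str_dist_wrong[of i x] i x length_strs[of x] by metis
  ultimately show ?thesis by simp
qed

lemma not_achievable_below:
  assumes "T < N" "K \<ge> 2" "R < 1 / real (N - T)"
  shows "\<not> achievable K N T R D"
proof
  \<comment> \<open>Half of the gap keeps \<open>R + \<epsilon>\<close> strictly below the
    threshold.\<close>
  define \<epsilon> where "\<epsilon> = (1 / real (N - T) - R) / 2"
  have "(r - R) / 2 > 0 \<and> R + (r - R) / 2 < r" if "R < r" for r :: real
    using that by (simp add: field_simps)
  from this[OF assms(3)] have \<epsilon>: "\<epsilon> > 0" and half: "R + \<epsilon> < 1 / real (N - T)"
    unfolding \<epsilon>_def by auto
  assume "achievable K N T R D"
  with \<epsilon> obtain n m f g where c: "is_code K N n m f g" "feasible K N n f g"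
    and r: "real m / real n \<le> R + \<epsilon>" and D: "D_T K N T n m f g \<le> ereal (D + \<epsilon>)"
    unfolding achievable_def by blast
  have n: "n > 0" using c unfolding is_code_def by auto
  have "real m / real n < 1 / real (N - T)" using le_less_trans[OF r half] .
  hence "real m * real (N - T) < real n" using n assms(1) by (simp add: field_simps)
  hence "m * (N - T) < n" by (metis of_nat_less_iff of_nat_mult)
  from D_T_infinite[OF _ assms(2) c this] assms(1) D show False by simp
qed

section \<open>Mixing the erasure code with the exact code\<close>

theorem theorem1:
  fixes K N T :: nat
  assumes "K \<ge> 2" and "T \<ge> 1" and "N \<ge> T + T\<^sup>2 div 4 + 2"
  shows "(\<forall>R::real. 0 \<le> R \<and> R < 1 / real (N - T) \<longrightarrow> \<not> (\<exists>D::real. achievable K N T R D))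
       \<and> (\<forall>R::real. 1 / real (N - T) \<le> R \<and> R \<le> 1 / (real N - 2 * real T) \<longrightarrow>
            achievable K N T R
              (real (T + T\<^sup>2 div 4 + 1) * (real N - real T) * (1 - (real N - 2 * real T) * R)
                 / (real N * real T)))"
proof (intro conjI allI impI)
  \<comment> \<open>The factors \<open>T - 1\<close> and \<open>1\<close> give
    \<open>T - 1 \<le> T\<^sup>2 div 4\<close>, so the bound on \<open>N\<close> implies
    \<open>N \<ge> 2 * T + 1\<close>.\<close>
  have "(T - 1) * (T - (T - 1)) \<le> T\<^sup>2 div 4" by (rule mult_diff_le_quarter_square)
  hence NT: "2 * T < N" using assms(2,3) by simp
  {
    fix R :: real assume "0 \<le> R \<and> R < 1 / real (N - T)"
    thus "\<not> (\<exists>D::real. achievable K N T R D)"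
      using not_achievable_below[of T N K R] NT assms by auto
  }
  fix R :: real assume R: "1 / real (N - T) \<le> R \<and> R \<le> 1 / (real N - 2 * real T)"
  define F where "F = T + T\<^sup>2 div 4 + 1"
  define x y where "x = real (N - T)" and "y = real (N - 2 * T)"
  have pos: "0 < y" and T: "real T = x - y" "real T > 0" unfolding x_def y_def using NT assms(2) by auto
  have x: "x = real N - real T" and y: "y = real N - 2 * real T" unfolding x_def y_def using NT by auto
  \<comment> \<open>The solution of \<open>\<theta> / x + (1 - \<theta>) / y = R\<close>, using
    \<open>x - y = T\<close>; the two bounds on \<open>R\<close> amount to
    \<open>0 \<le> \<theta> \<le> 1\<close>.\<close>
  define \<theta> where "\<theta> = x * (1 - y * R) / real T"
  have R': "1 \<le> R * x" "R * y \<le> 1" using R pos T unfolding x_def[symmetric] y[symmetric] by (auto simp: field_simps)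
  have \<theta>: "0 \<le> \<theta>" "\<theta> \<le> 1"
  proof -
    show "0 \<le> \<theta>" unfolding \<theta>_def using R' pos T by (simp add: mult.commute)
    have "y * 1 \<le> y * (R * x)" using R' pos by (intro mult_left_mono) auto
    thus "\<theta> \<le> 1" unfolding \<theta>_def using T by (simp add: field_simps)
  qed
  have code1: "\<exists>n m e. n > 0 \<and> robust_code K N T n m e \<and> real m / real n \<le> 1 / x + \<epsilon> \<and> real e / real n \<le> F / real N"
    if \<epsilon>: "\<epsilon> > 0" for \<epsilon>
  proof -
    obtain n m e where c: "n > 0" "robust_code K N T n m e" "real m / real n \<le> 1 / x + \<epsilon>" "e * N = F * n"
      using rs_robust_code[OF assms(1) _ _ \<epsilon> rs_robust_erasure[OF NT]] NT unfolding F_def x_def by fastforce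
    have "real e * real N = real F * real n" using c(4) by (metis of_nat_mult)
    thus ?thesis using c(1-3) NT by (intro exI[of _ n] exI[of _ m] exI[of _ e]) (simp add: field_simps)
  qed
  have code2: "\<exists>n m e. n > 0 \<and> robust_code K N T n m e \<and> real m / real n \<le> 1 / y + \<epsilon> \<and> real e / real n \<le> 0"
    if \<epsilon>: "\<epsilon> > 0" for \<epsilon>
  proof -
    have "robust N T (rs_source N (N - 2 * T) L \<rightarrow>\<^sub>E A) (rs_packet N (N - 2 * T) L)
        (rs_source N (N - 2 * T) L) (\<lambda>\<sigma> i. \<sigma> i) (0 * ((N - 2 * T) * L))" for L and A :: "nat set"
      using rs_robust_exact[OF NT] by simp
    from rs_robust_code[OF assms(1) _ _ \<epsilon> this] obtain n m e
      where "n > 0" "robust_code K N T n m e" "real m / real n \<le> 1 / y + \<epsilon>" "e * N = 0 * n"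
      using NT unfolding y_def by auto
    thus ?thesis using NT by (intro exI[of _ n] exI[of _ m] exI[of _ e]) simp
  qed
  have "achievable K N T (\<theta> * (1 / x) + (1 - \<theta>) * (1 / y)) (\<theta> * (F / real N) + (1 - \<theta>) * 0)"
    by (rule achievable_time_sharing[OF code1 code2 \<theta>])
  moreover have "\<theta> * (1 / x) + (1 - \<theta>) * (1 / y) = R"
  proof -
    have "\<theta> * (1 / x) + (1 - \<theta>) * (1 / y) = 1 / y - \<theta> * real T / (x * y)"
      unfolding T(1) using pos T by (simp add: field_simps)
    also have "\<theta> * real T = x * (1 - y * R)" unfolding \<theta>_def using T by simp
    also have "1 / y - x * (1 - y * R) / (x * y) = R" using pos T by (simp add: field_simps)
    finally show ?thesis .
  qed
  moreover have "\<theta> * (F / real N) + (1 - \<theta>) * 0 = real F * x * (1 - y * R) / (real N * real T)"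
    unfolding \<theta>_def by (simp add: mult_ac)
  ultimately show "achievable K N T R
      (real (T + T\<^sup>2 div 4 + 1) * (real N - real T) * (1 - (real N - 2 * real T) * R) / (real N * real T))"
    unfolding F_def x y by simp
qed

end
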